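(* Consider $$\frac{\partial u}{\partial t}=\frac{\partial^2u}{\partial z^2}+f(t,u),\qquad z\in\mathbb{R},\ t>0, \qquad( * )$$ where $f:\mathbb{R}\times\mathbb{R}\to\mathbb{R}$ is $C^1$-admissible and uniformly almost periodic in $t$. Let $u_\pm^f(t)$ be spatially homogeneous time-almost periodic solutions of $( * )$ with $\mathcal{M}(u^f_\pm)\subset\mathcal{M}(f)$, and assume there exist $\epsilon_0>0$ and $\mu>0$ such that $$\frac{\partial f}{\partial u}(t,u)\le-\mu\qquad\text{for }|u-u^f_\pm(t)|<\epsilon_0\text{ and }t\in\mathbb{R}.$$ Traveling waves of $( * )$ are understood to be almost periodic traveling waves $\phi(z-c(t),t)$ satisfying the connecting condition $\lim_{x\to\pm\infty}\phi(x,t)=u^f_\pm(t)$ uniformly for $t\in\mathbb{R}$. Then any uniformly stable traveling wave of $( * )$ is spatially monotone. In particular, solitary waves of $( * )$ are not uniformly stable.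
   Context: Almost periodic: a continuous function $F(t)$ is almost periodic if for every $\varepsilon>0$ the set $\{\tau:|F(t+\tau)-F(t)|<\varepsilon\ \forall t\in\mathbb{R}\}$ is relatively dense in $\mathbb{R}$. Admissible: a continuous function $F(t,w)$ on $\mathbb{R}\times D$, $D\subset\mathbb{R}^m$, is admissible if it is bounded and uniformly continuous on $\mathbb{R}\times C$ for every compact $C\subset D$. $C^1$-admissible is the $C^1$ version of this notion: $f$ is continuously differentiable in $u$, and $f$ and $\partial f/\partial u$ are admissible. $F$ is uniformly almost periodic in $t$ if it is admissible and almost periodic in $t$. Frequency module $\mathcal{M}(F)$ of an almost periodic function $F(t,w)\sim\sum_\lambda a_\lambda(w)e^{i\lambda t}$ (Fourier series): the smallest additive subgroup of $\mathbb{R}$ containing $\{\lambda:a_\lambda\not\equiv0\}$. Almost periodic traveling wave of $( * )$: a solution of the form $u(z,t)=\phi(z-c(t),t)$ with $\phi\in C^1(\mathbb{R}\times\mathbb{R},\mathbb{R})$, $c\in C^1(\mathbb{R},\mathbb{R})$, where $\phi(x,t)$ is almost periodic in $t$ uniformly with respect to $x$ in bounded sets, $c'(t)$ is almost periodic in $t$, and $\mathcal{M}(\phi(x,\cdot)),\mathcal{M}(c')\subset\mathcal{M}(f)$. A traveling wave is called a solitary wave if $u^f_+(t)=u^f_-(t)$ for all $t\in\mathbb{R}$. $X=C_{\rm unif}(\mathbb{R})$ is the space of bounded uniformly continuous functions on $\mathbb{R}$ with the $L^\infty$ topology; for $u_0\in X$, $u(\cdot,t;u_0,f)$ is the solution of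 $( * )$ with $u(\cdot,0;u_0,f)=u_0$. The wave is uniformly stable if for every $\varepsilon>0$ there is $\delta(\varepsilon)>0$ such that for every $u_0\in X$, if $s\ge0$ and $\|u(\cdot,s;u_0,f)-\phi(\cdot-c(s),s)\|_{L^\infty}\le\delta(\varepsilon)$, then $\|u(\cdot,t;u_0,f)-\phi(\cdot-c(t),t)\|_{L^\infty}<\varepsilon$ for each $t\ge s$. It is spatially monotone if $\phi(x,t)$ is a non-decreasing or non-increasing function of $x$ for every $t\in\mathbb{R}$.
   Formalization: Solitary waves are additionally required not to be spatially homogeneous, since the homogeneous solution φ(x,t)=u_±(t) (e.g. φ=0 for f=-u) satisfies u_+=u_- and is uniformly stable, so the last claim would otherwise be false. *)

theory Defs
  imports "HOL-Analysis.Analysis" "HOL-Computational_Algebra.Group_Closure"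
begin

section \<open>Almost periodicity\<close>

definition relatively_dense :: "real set \<Rightarrow> bool" where
  "relatively_dense S \<longleftrightarrow> (\<exists>L>0. \<forall>a. \<exists>\<tau>\<in>S. a \<le> \<tau> \<and> \<tau> \<le> a + L)"

definition almost_periodic :: "(real \<Rightarrow> real) \<Rightarrow> bool" where
  "almost_periodic F \<longleftrightarrow> continuous_on UNIV F \<and>
     (\<forall>\<epsilon>>0. relatively_dense {\<tau>. \<forall>t. \<bar>F (t + \<tau>) - F t\<bar> < \<epsilon>})"

definition admissible :: "'w::euclidean_space set \<Rightarrow> (real \<Rightarrow> 'w \<Rightarrow> real) \<Rightarrow> bool" where
  "admissible D F \<longleftrightarrow> continuous_on (UNIV \<times> D) (\<lambda>(t, w). F t w) \<and>
     (\<forall>C. compact C \<and> C \<subseteq> D \<longrightarrow>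
        bounded ((\<lambda>(t, w). F t w) ` (UNIV \<times> C)) \<and>
        uniformly_continuous_on (UNIV \<times> C) (\<lambda>(t, w). F t w))"

text \<open>Continuity of the \<open>u\<close>-derivative is part of its admissibility.\<close>

definition C1_admissible :: "(real \<Rightarrow> real \<Rightarrow> real) \<Rightarrow> bool" where
  "C1_admissible f \<longleftrightarrow> (\<forall>t u. f t differentiable (at u)) \<and>
     admissible UNIV f \<and> admissible UNIV (\<lambda>t. deriv (f t))"

definition uniformly_almost_periodic ::
    "'w::euclidean_space set \<Rightarrow> (real \<Rightarrow> 'w \<Rightarrow> real) \<Rightarrow> bool" where
  "uniformly_almost_periodic D F \<longleftrightarrow> admissible D F \<and> (\<forall>w\<in>D. almost_periodic (\<lambda>t. F t w))"

text \<open>Almost periodicity of \<open>\<phi> x t\<close> in the second argument \<open>t\<close>, uniformly for \<open>x\<close> in bounded sets: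
  the \<open>\<epsilon>\<close>-almost periods can be chosen independently of \<open>x \<in> B\<close>.\<close>

definition almost_periodic_unif_bounded :: "(real \<Rightarrow> real \<Rightarrow> real) \<Rightarrow> bool" where
  "almost_periodic_unif_bounded \<phi> \<longleftrightarrow> continuous_on UNIV (\<lambda>(x, t). \<phi> x t) \<and>
     (\<forall>B. bounded B \<longrightarrow>
        (\<forall>\<epsilon>>0. relatively_dense {\<tau>. \<forall>x\<in>B. \<forall>t. \<bar>\<phi> x (t + \<tau>) - \<phi> x t\<bar> < \<epsilon>}))"

text \<open>The Fourier coefficient at frequency \<open>\<xi>\<close> of an almost periodic function is the mean value of
  \<open>F t * exp (- i \<xi> t)\<close>; for almost periodic \<open>F\<close> the limit exists.\<close>

definition fourier_coeff :: "(real \<Rightarrow> real) \<Rightarrow> real \<Rightarrow> complex" where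
  "fourier_coeff F \<xi> =
     Lim at_top (\<lambda>T. integral {0..T} (\<lambda>t. of_real (F t) * exp (- \<i> * of_real (\<xi> * t))) / of_real T)"

definition frequency_module :: "(real \<Rightarrow> 'w \<Rightarrow> real) \<Rightarrow> real set" where
  "frequency_module F = group_closure {\<xi>. \<exists>w. fourier_coeff (\<lambda>t. F t w) \<xi> \<noteq> 0}"

text \<open>The module of a function of \<open>t\<close> alone: the parameter space is a point.\<close>

definition frequency_module1 :: "(real \<Rightarrow> real) \<Rightarrow> real set" where
  "frequency_module1 F = frequency_module (\<lambda>t (_::unit). F t)"

section \<open>Solutions of the equation\<close>

text \<open>Functions of space and time are written \<open>u z t\<close>. The equation
  \<open>u\<^sub>t = u\<^sub>z\<^sub>z + f(t,u)\<close> holds classically for \<open>z \<in> \<real>\<close>, \<open>t \<in> J\<close>, where \<open>J\<close> is an open set of times.\<close>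

definition classical_solution ::
    "(real \<Rightarrow> real \<Rightarrow> real) \<Rightarrow> real set \<Rightarrow> (real \<Rightarrow> real \<Rightarrow> real) \<Rightarrow> bool" where
  "classical_solution f J u \<longleftrightarrow> (\<exists>ut uz uzz :: real \<Rightarrow> real \<Rightarrow> real.
     continuous_on (UNIV \<times> J) (\<lambda>(z, t). ut z t) \<and>
     continuous_on (UNIV \<times> J) (\<lambda>(z, t). uz z t) \<and>
     continuous_on (UNIV \<times> J) (\<lambda>(z, t). uzz z t) \<and>
     (\<forall>z. \<forall>t\<in>J.
        ((\<lambda>s. u z s) has_real_derivative ut z t) (at t) \<and>
        ((\<lambda>y. u y t) has_real_derivative uz z t) (at z) \<and>
        ((\<lambda>y. uz y t) has_real_derivative uzz z t) (at z) \<and>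
        ut z t = uzz z t + f t (u z t)))"

definition C_unif :: "(real \<Rightarrow> real) set" where
  "C_unif = {g. bounded (range g) \<and> uniformly_continuous_on UNIV g}"

text \<open>The \<open>L\<^sup>\<infinity>\<close> norm, for bounded continuous functions.\<close>

definition sup_norm :: "(real \<Rightarrow> real) \<Rightarrow> real" where
  "sup_norm g = (SUP z. \<bar>g z\<bar>)"

text \<open>\<open>u\<close> is the solution \<open>u(\<cdot>,t;u\<^sub>0,f)\<close> on a time interval \<open>I\<close> (\<open>{0..T}\<close> or \<open>{0..}\<close>):
  a continuous curve \<open>I \<rightarrow> C_unif\<close> in the \<open>L\<^sup>\<infinity>\<close> topology starting at \<open>u\<^sub>0\<close>
  and solving the equation in the interior of \<open>I\<close>.\<close>

definition cauchy_solution ::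
    "(real \<Rightarrow> real \<Rightarrow> real) \<Rightarrow> real set \<Rightarrow> (real \<Rightarrow> real) \<Rightarrow> (real \<Rightarrow> real \<Rightarrow> real) \<Rightarrow> bool" where
  "cauchy_solution f I u0 u \<longleftrightarrow>
     (\<forall>z. u z 0 = u0 z) \<and>
     (\<forall>t\<in>I. (\<lambda>z. u z t) \<in> C_unif) \<and>
     (\<forall>t\<in>I. uniform_limit UNIV (\<lambda>s z. u z s) (\<lambda>z. u z t) (at t within I)) \<and>
     classical_solution f (interior I) u"

section \<open>Traveling waves\<close>

definition C1_plane :: "(real \<Rightarrow> real \<Rightarrow> real) \<Rightarrow> bool" where
  "C1_plane \<phi> \<longleftrightarrow> (\<exists>D :: real \<times> real \<Rightarrow> (real \<times> real) \<Rightarrow>\<^sub>L real.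
     continuous_on UNIV D \<and>
     (\<forall>p. ((\<lambda>(x, t). \<phi> x t) has_derivative blinfun_apply (D p)) (at p)))"

definition ap_traveling_wave ::
    "(real \<Rightarrow> real \<Rightarrow> real) \<Rightarrow> (real \<Rightarrow> real \<Rightarrow> real) \<Rightarrow> (real \<Rightarrow> real) \<Rightarrow> bool" where
  "ap_traveling_wave f \<phi> c \<longleftrightarrow>
     C1_plane \<phi> \<and> c C1_differentiable_on UNIV \<and>
     classical_solution f {0<..} (\<lambda>z t. \<phi> (z - c t) t) \<and>
     almost_periodic_unif_bounded \<phi> \<and> almost_periodic (deriv c) \<and>
     (\<forall>x. frequency_module1 (\<phi> x) \<subseteq> frequency_module f) \<and>
     frequency_module1 (deriv c) \<subseteq> frequency_module f"

text \<open>The limits as \<open>x \<rightarrow> \<plusminus>\<infinity>\<close> are uniform in \<open>t \<in> \<real>\<close>.\<close>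

definition connects ::
    "(real \<Rightarrow> real \<Rightarrow> real) \<Rightarrow> (real \<Rightarrow> real) \<Rightarrow> (real \<Rightarrow> real) \<Rightarrow> bool" where
  "connects \<phi> u_minus u_plus \<longleftrightarrow>
     uniform_limit UNIV \<phi> u_plus at_top \<and> uniform_limit UNIV \<phi> u_minus at_bot"

text \<open>A solitary wave is understood to be a genuine wave: the spatially homogeneous
  solution \<open>\<phi> x t = u_plus t = u_minus t\<close> is excluded.\<close>

definition solitary_wave ::
    "(real \<Rightarrow> real \<Rightarrow> real) \<Rightarrow> (real \<Rightarrow> real) \<Rightarrow> (real \<Rightarrow> real) \<Rightarrow> bool" where
  "solitary_wave \<phi> u_minus u_plus \<longleftrightarrow>
     (\<forall>t. u_plus t = u_minus t) \<and> (\<exists>t x y. \<phi> x t \<noteq> \<phi> y t)"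

text \<open>Since \<open>f\<close> may be superlinear, \<open>u(\<cdot>,t;u\<^sub>0,f)\<close> need not exist for all \<open>t \<ge> 0\<close>. The hypothesis
  concerns data whose solution exists up to time \<open>s\<close>; that it exists for all later times is part
  of the conclusion.\<close>

definition uniformly_stable ::
    "(real \<Rightarrow> real \<Rightarrow> real) \<Rightarrow> (real \<Rightarrow> real \<Rightarrow> real) \<Rightarrow> (real \<Rightarrow> real) \<Rightarrow> bool" where
  "uniformly_stable f \<phi> c \<longleftrightarrow>
     (\<forall>\<epsilon>>0. \<exists>\<delta>>0. \<forall>u0\<in>C_unif. \<forall>s\<ge>0. \<forall>u.
        cauchy_solution f {0..s} u0 u \<and> sup_norm (\<lambda>z. u z s - \<phi> (z - c s) s) \<le> \<delta> \<longrightarrow>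
        (\<exists>v. cauchy_solution f {0..} u0 v \<and>
             (\<forall>t\<ge>s. sup_norm (\<lambda>z. v z t - \<phi> (z - c t) t) < \<epsilon>)))"

definition spatially_monotone :: "(real \<Rightarrow> real \<Rightarrow> real) \<Rightarrow> bool" where
  "spatially_monotone \<phi> \<longleftrightarrow> (\<forall>t. mono (\<lambda>x. \<phi> x t)) \<or> (\<forall>t. antimono (\<lambda>x. \<phi> x t))"

end

theory Submission
  imports Defs
begin

text \<open>
  Write \<open>W z t = \<phi> (z - c t) t\<close> and let \<open>V\<close> be the solution starting from \<open>W(\<cdot>,0) + \<delta>\<close>; by
  stability it exists and stays \<open>\<epsilon>\<close>-close to \<open>W\<close>. By comparison \<open>V\<close> stays above all small
  translates \<open>W(\<cdot> + b, t)\<close>. Slide: let \<open>a\<close> be the largest shift such that \<open>V\<close> is asymptotically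
  above \<open>W(\<cdot> + b, t)\<close> for all \<open>b \<in> [0, a]\<close>.

  If \<open>a = \<infinity>\<close>, then \<open>\<phi>(x + b, t) \<le> \<phi>(x, t) + \<epsilon>\<close> for large \<open>t\<close>, hence for all \<open>t\<close> by almost
  periodicity; if this happens for all small \<open>\<epsilon>\<close>, then \<open>\<phi>\<close> is non-increasing.

  If \<open>a < \<infinity>\<close>, then \<open>V - W(\<cdot> + a)\<close> becomes arbitrarily small in the sup norm at suitable times:
  otherwise it would be large somewhere in a tube \<open>\<bar>z - c t\<bar> \<le> R\<close>, by a Gaussian lower bound it
  would be uniformly positive in that tube, and since the equation is dissipative outside the
  tube one could slide further. Applying stability once more, \<open>V\<close> converges to \<open>W(\<cdot> + a)\<close>,
  so \<open>\<phi>(x + b, t) \<le> \<phi>(x + a, t)\<close> for \<open>b \<in> [0, a]\<close> and \<open>\<phi>\<close> is non-decreasing.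
\<close>

section \<open>A maximum principle\<close>

text \<open>\<open>g'\<close> vanishes at the maximum. If \<open>l\<close> were positive,
  \<open>g'\<close> would be positive just to the right of \<open>x\<close>, and the mean value
  theorem would give a larger value of \<open>g\<close> there.\<close>

lemma second_derivative_nonpos_at_max:
  fixes g g' :: "real \<Rightarrow> real"
  assumes "\<forall>\<^sub>F y in nhds x. (g has_real_derivative g' y) (at y)"
    and "(g' has_real_derivative l) (at x)"
    and max: "\<And>y. g y \<le> g x"
  shows "l \<le> 0"
proof (rule ccontr)
  assume "\<not> l \<le> 0"
  then have "l > 0" by simp
  obtain e where e: "e > 0" "\<And>y. dist y x < e \<Longrightarrow> (g has_real_derivative g' y) (at y)"
    using assms(1) unfolding eventually_nhds_metric by auto
  have "g' x = 0"
    by (rule DERIV_local_max[OF e(2)[of x] e(1)]) (use e(1) max in auto)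
  obtain d where d: "d > 0" "\<And>h. 0 < h \<Longrightarrow> h < d \<Longrightarrow> g' x < g' (x + h)"
    using has_real_derivative_pos_inc_right[OF assms(2) \<open>l > 0\<close>] by auto
  define h where "h = min d e / 2"
  have h: "0 < h" "h < d" "h < e" using d(1) e(1) by (auto simp: h_def min_def)
  obtain \<xi> where \<xi>: "x < \<xi>" "\<xi> < x + h" "g (x + h) - g x = (x + h - x) * g' \<xi>"
  proof (rule MVT2[of x "x + h" g g', THEN exE])
    show "x < x + h" using h by simp
    show "(g has_real_derivative g' y) (at y)" if "x \<le> y" "y \<le> x + h" for y
      using that h by (intro e(2)) (auto simp: dist_real_def)
  qed auto
  have "g' \<xi> > 0" using d(2)[of "\<xi> - x"] \<xi> h \<open>g' x = 0\<close> by auto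
  then have "g (x + h) - g x > 0" using \<xi> h by simp
  then show False using max[of "x + h"] by simp
qed

text \<open>The differential inequality is needed only where \<open>F > 0\<close>, so no spatial domain appears:
  a boundary condition becomes the statement that \<open>F \<le> 0\<close> off the domain.\<close>

lemma parabolic_max_principle2:
  fixes F :: "real \<Rightarrow> real \<Rightarrow> real \<Rightarrow> real"
  assumes cont: "continuous_on (UNIV \<times> UNIV \<times> {s..T}) (\<lambda>(x, y, t). F x y t)"
    and bound: "\<And>x y t. s \<le> t \<Longrightarrow> t \<le> T \<Longrightarrow> F x y t \<le> M"
    and init: "\<And>x y. F x y s \<le> 0"
    and sub: "\<And>x y t. s < t \<Longrightarrow> t \<le> T \<Longrightarrow> F x y t > 0 \<Longrightarrow>
      \<exists>Ft Fx Fxx Fy Fyy. (F x y has_real_derivative Ft) (at t) \<and>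
        (\<forall>\<^sub>F x' in nhds x. ((\<lambda>x. F x y t) has_real_derivative Fx x') (at x')) \<and>
        (Fx has_real_derivative Fxx) (at x) \<and>
        (\<forall>\<^sub>F y' in nhds y. ((\<lambda>y. F x y t) has_real_derivative Fy y') (at y')) \<and>
        (Fy has_real_derivative Fyy) (at y) \<and>
        Ft \<le> Fxx + Fyy + B * F x y t"
    and t0: "s \<le> t0" "t0 \<le> T"
  shows "F x0 y0 t0 \<le> 0"
proof (rule ccontr)
  assume "\<not> F x0 y0 t0 \<le> 0"
  then have pos: "F x0 y0 t0 > 0" by simp
  \<comment> \<open>This integrating factor absorbs the zeroth-order term
    \<open>B * F\<close>.\<close>
  define E where "E t = exp (- B * (t - s))" for t
  have E: "E t > 0" for t by (simp add: E_def)
  \<comment> \<open>The penalty grows in space, so a positive maximum is attained on a compact set.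
    Its rate 5 in time exceeds 4, the Laplacian of \<open>x\<^sup>2 + y\<^sup>2\<close>, which makes
    the inequality at the maximum strict; the final 1 keeps \<open>Q\<close> positive at time
    \<open>s\<close>.\<close>
  define Q where "Q x y t = x\<^sup>2 + y\<^sup>2 + 5 * (t - s) + 1" for x y t :: real
  have Q1: "Q x y t \<ge> 1" if "s \<le> t" for x y t using that by (simp add: Q_def)
  \<comment> \<open>With this size the penalty removes exactly half of the weighted positive value
    at \<open>(x0, y0, t0)\<close>.\<close>
  define \<epsilon> where "\<epsilon> = E t0 * F x0 y0 t0 / (2 * Q x0 y0 t0)"
  have Q0: "Q x0 y0 t0 > 0" using Q1[OF t0(1), of x0 y0] by simp
  then have \<epsilon>: "\<epsilon> > 0" using pos E by (simp add: \<epsilon>_def)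
  define G where "G x y t = E t * F x y t - \<epsilon> * Q x y t" for x y t
  have G0: "G x0 y0 t0 > 0" using Q0 pos E[of t0] by (simp add: G_def \<epsilon>_def field_simps)
  define K where "K = exp (\<bar>B\<bar> * (T - s)) * max M 0 / \<epsilon>"
  have K0: "K \<ge> 0" using \<epsilon> by (simp add: K_def)
  have Gneg: "x\<^sup>2 + y\<^sup>2 \<le> K" if "G x y t > 0" "s \<le> t" "t \<le> T" for x y t
  proof -
    have "\<epsilon> * (x\<^sup>2 + y\<^sup>2) \<le> \<epsilon> * Q x y t"
      using \<epsilon> that by (intro mult_left_mono) (auto simp: Q_def)
    also have "\<dots> < E t * F x y t" using that by (simp add: G_def)
    also have "\<dots> \<le> E t * max M 0"
      using bound[OF that(2,3), of x y] E[of t] by (intro mult_left_mono) auto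
    also have "\<dots> \<le> exp (\<bar>B\<bar> * (T - s)) * max M 0"
    proof (rule mult_right_mono)
      have "- B * (t - s) \<le> \<bar>B\<bar> * (t - s)" using that by (intro mult_right_mono) auto
      also have "\<dots> \<le> \<bar>B\<bar> * (T - s)" using that by (intro mult_left_mono) auto
      finally show "E t \<le> exp (\<bar>B\<bar> * (T - s))" by (simp add: E_def)
    qed simp
    finally show ?thesis using \<epsilon> by (simp add: K_def field_simps)
  qed
  have sq: "\<bar>x\<bar> \<le> K + 1" if "x\<^sup>2 \<le> K" for x :: real
  proof -
    have "x\<^sup>2 \<le> 1 + 2 * K + K\<^sup>2" using that K0 zero_le_power2[of K] by linarith
    then have "x\<^sup>2 \<le> (K + 1)\<^sup>2" by (simp add: power2_sum)
    then show ?thesis using K0 abs_le_square_iff[of x "K + 1"] by simp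
  qed
  define X where "X = {- (K + 1)..K + 1}"
  have inX: "x \<in> X \<and> y \<in> X" if "G x y t > 0" "s \<le> t" "t \<le> T" for x y t
  proof -
    have "x\<^sup>2 \<le> K" "y\<^sup>2 \<le> K"
      using Gneg[OF that] zero_le_power2[of x] zero_le_power2[of y] by linarith+
    then show ?thesis using sq[of x] sq[of y] by (auto simp: X_def)
  qed
  define S where "S = X \<times> X \<times> {s..T}"
  have "compact S" by (auto simp: S_def X_def intro!: compact_Times)
  have contF: "continuous_on S (\<lambda>p. F (fst p) (fst (snd p)) (snd (snd p)))"
    using continuous_on_subset[OF cont, of S] by (auto simp: S_def case_prod_beta)
  have "continuous_on S (\<lambda>p. G (fst p) (fst (snd p)) (snd (snd p)))"
    unfolding G_def E_def Q_def by (intro continuous_intros contF)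
  moreover have "(x0, y0, t0) \<in> S" using inX[OF G0 t0] t0 by (simp add: S_def)
  ultimately obtain p where p: "p \<in> S"
    "\<And>q. q \<in> S \<Longrightarrow> G (fst q) (fst (snd q)) (snd (snd q)) \<le> G (fst p) (fst (snd p)) (snd (snd p))"
    using continuous_attains_sup[OF \<open>compact S\<close>, of "\<lambda>p. G (fst p) (fst (snd p)) (snd (snd p))"]
    by blast
  obtain x y t where xyt: "p = (x, y, t)" by (cases p) auto
  have t: "s \<le> t" "t \<le> T" using p(1) xyt by (auto simp: S_def)
  have Gp: "G x y t > 0" using p(2)[OF \<open>(x0, y0, t0) \<in> S\<close>] G0 xyt by simp
  have max: "G x' y' t' \<le> G x y t" if "s \<le> t'" "t' \<le> T" for x' y' t'
  proof (cases "G x' y' t' > 0")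
    case True
    then have "(x', y', t') \<in> S" using inX[OF True that] that by (simp add: S_def)
    then show ?thesis using p(2) xyt by fastforce
  qed (use Gp in simp)
  have "E s * F x y s \<le> 0" using init[of x y] E[of s] by (simp add: mult_nonneg_nonpos)
  moreover have "\<epsilon> * Q x y s > 0" using \<epsilon> Q1[of s x y] by (intro mult_pos_pos) auto
  ultimately have "G x y s < 0" by (simp add: G_def)
  then have ts: "s < t" using Gp t by (cases "s = t") auto
  have "E t * F x y t > 0" using Gp \<epsilon> Q1[OF t(1), of x y] unfolding G_def
    by (smt (verit) mult_pos_pos)
  then have Fp: "F x y t > 0" using E[of t] by (simp add: zero_less_mult_iff)
  obtain Ft Fx Fxx Fy Fyy where d: "(F x y has_real_derivative Ft) (at t)"
    "\<forall>\<^sub>F x' in nhds x. ((\<lambda>x. F x y t) has_real_derivative Fx x') (at x')"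
    "(Fx has_real_derivative Fxx) (at x)"
    "\<forall>\<^sub>F y' in nhds y. ((\<lambda>y. F x y t) has_real_derivative Fy y') (at y')"
    "(Fy has_real_derivative Fyy) (at y)"
    "Ft \<le> Fxx + Fyy + B * F x y t"
    using sub[OF ts t(2) Fp] by blast
  have x1: "((\<lambda>x. E t * Fx x - \<epsilon> * (2 * x)) has_real_derivative E t * Fxx - \<epsilon> * 2) (at x)"
    by (auto intro!: derivative_eq_intros d(3))
  have x2: "\<forall>\<^sub>F x' in nhds x. ((\<lambda>x. G x y t) has_real_derivative E t * Fx x' - \<epsilon> * (2 * x')) (at x')"
    using d(2) by eventually_elim (auto simp: G_def Q_def intro!: derivative_eq_intros)
  have xx: "E t * Fxx - \<epsilon> * 2 \<le> 0"
    by (rule second_derivative_nonpos_at_max[OF x2 x1 max[OF t]])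
  have y1: "((\<lambda>y. E t * Fy y - \<epsilon> * (2 * y)) has_real_derivative E t * Fyy - \<epsilon> * 2) (at y)"
    by (auto intro!: derivative_eq_intros d(5))
  have y2: "\<forall>\<^sub>F y' in nhds y. ((\<lambda>y. G x y t) has_real_derivative E t * Fy y' - \<epsilon> * (2 * y')) (at y')"
    using d(4) by eventually_elim (auto simp: G_def Q_def intro!: derivative_eq_intros)
  have yy: "E t * Fyy - \<epsilon> * 2 \<le> 0"
    by (rule second_derivative_nonpos_at_max[OF y2 y1 max[OF t]])
  define D where "D = E t * Ft - B * E t * F x y t - \<epsilon> * 5"
  have dt: "(G x y has_real_derivative D) (at t)"
    unfolding G_def E_def Q_def D_def
    by (auto intro!: derivative_eq_intros d(1) simp: algebra_simps)
  \<comment> \<open>Only times before \<open>t\<close> are compared, because the maximum may sit at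
    the final time \<open>T\<close>.\<close>
  have "D \<ge> 0"
  proof (rule ccontr)
    assume "\<not> D \<ge> 0"
    then obtain e where e: "e > 0" "\<And>h. 0 < h \<Longrightarrow> h < e \<Longrightarrow> G x y t < G x y (t - h)"
      using has_real_derivative_neg_dec_left[OF dt] by auto
    define h where "h = min e (t - s) / 2"
    have "0 < h" "h < e" "h \<le> t - s" using e(1) ts by (auto simp: h_def min_def field_simps)
    then show False using e(2)[of h] max[of "t - h" x y] t by auto
  qed
  moreover have "E t * Ft \<le> E t * Fxx + E t * Fyy + E t * (B * F x y t)"
    using mult_left_mono[OF d(6), of "E t"] E[of t] by (simp add: algebra_simps)
  ultimately show False using xx yy \<epsilon> by (simp add: D_def algebra_simps)
qed

lemma parabolic_max_principle:
  fixes F :: "real \<Rightarrow> real \<Rightarrow> real"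
  assumes cont: "continuous_on (UNIV \<times> {s..T}) (\<lambda>(x, t). F x t)"
    and bound: "\<And>x t. s \<le> t \<Longrightarrow> t \<le> T \<Longrightarrow> F x t \<le> M"
    and init: "\<And>x. F x s \<le> 0"
    and sub: "\<And>x t. s < t \<Longrightarrow> t \<le> T \<Longrightarrow> F x t > 0 \<Longrightarrow>
      \<exists>Ft Fx Fxx. (F x has_real_derivative Ft) (at t) \<and>
        (\<forall>x'. ((\<lambda>x. F x t) has_real_derivative Fx x') (at x')) \<and>
        (Fx has_real_derivative Fxx) (at x) \<and> Ft \<le> Fxx + B * F x t"
    and t0: "s \<le> t0" "t0 \<le> T"
  shows "F x0 t0 \<le> 0"
proof -
  have "continuous_on (UNIV \<times> UNIV \<times> {s..T}) ((\<lambda>(x, t). F x t) \<circ> (\<lambda>p. (fst p, snd (snd p))))"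
    by (intro continuous_on_compose continuous_intros continuous_on_subset[OF cont]) auto
  then have c: "continuous_on (UNIV \<times> UNIV \<times> {s..T}) (\<lambda>(x, y::real, t). F x t)"
    by (simp add: o_def case_prod_beta)
  show ?thesis
  proof (rule parabolic_max_principle2[where F = "\<lambda>x y t. F x t" and B = B, OF c bound init _ t0])
    fix x y t assume "s < t" "t \<le> T" "F x t > 0"
    then obtain Ft Fx Fxx where d: "(F x has_real_derivative Ft) (at t)"
        "\<forall>x'. ((\<lambda>x. F x t) has_real_derivative Fx x') (at x')"
        "(Fx has_real_derivative Fxx) (at x)" "Ft \<le> Fxx + B * F x t"
      using sub by blast
    show "\<exists>Ft Fx Fxx Fy Fyy. (F x has_real_derivative Ft) (at t) \<and>
        (\<forall>\<^sub>F x' in nhds x. ((\<lambda>x. F x t) has_real_derivative Fx x') (at x')) \<and>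
        (Fx has_real_derivative Fxx) (at x) \<and>
        (\<forall>\<^sub>F y' in nhds y. ((\<lambda>y. F x t) has_real_derivative Fy y') (at y')) \<and>
        (Fy has_real_derivative Fyy) (at y) \<and>
        Ft \<le> Fxx + Fyy + B * F x t"
      using d by (intro exI[of _ Ft] exI[of _ Fx] exI[of _ Fxx] exI[of _ "\<lambda>_. 0"] exI[of _ 0]) auto
  qed
qed

section \<open>Bounded solutions\<close>

lemma classical_solutionE:
  assumes "classical_solution f J u"
  obtains ut uz uzz where
    "\<And>z t. t \<in> J \<Longrightarrow> (u z has_real_derivative ut z t) (at t)"
    "\<And>z t. t \<in> J \<Longrightarrow> ((\<lambda>y. u y t) has_real_derivative uz z t) (at z)"
    "\<And>z t. t \<in> J \<Longrightarrow> ((\<lambda>y. uz y t) has_real_derivative uzz z t) (at z)"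
    "\<And>z t. t \<in> J \<Longrightarrow> ut z t = uzz z t + f t (u z t)"
  using assms unfolding classical_solution_def by metis

lemma continuous_on_translate_plane:
  fixes u :: "real \<Rightarrow> real \<Rightarrow> real"
  assumes "continuous_on (UNIV \<times> J) (\<lambda>(z, t). u z t)"
  shows "continuous_on (UNIV \<times> J) (\<lambda>(z, t). u (z + a) t)"
proof -
  have "continuous_on (UNIV \<times> J) ((\<lambda>(z, t). u z t) \<circ> (\<lambda>p. (fst p + a, snd p)))"
    by (intro continuous_on_compose continuous_intros continuous_on_subset[OF assms]) auto
  then show ?thesis by (simp add: o_def case_prod_beta)
qed

lemma classical_solution_translate:
  assumes "classical_solution f J u"
  shows "classical_solution f J (\<lambda>z. u (z + a))"
proof -
  obtain ut uz uzz where d: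
    "continuous_on (UNIV \<times> J) (\<lambda>(z, t). ut z t)"
    "continuous_on (UNIV \<times> J) (\<lambda>(z, t). uz z t)"
    "continuous_on (UNIV \<times> J) (\<lambda>(z, t). uzz z t)"
    "\<And>z t. t \<in> J \<Longrightarrow> ((\<lambda>s. u z s) has_real_derivative ut z t) (at t) \<and>
        ((\<lambda>y. u y t) has_real_derivative uz z t) (at z) \<and>
        ((\<lambda>y. uz y t) has_real_derivative uzz z t) (at z) \<and>
        ut z t = uzz z t + f t (u z t)"
    using assms unfolding classical_solution_def by metis
  show ?thesis
    unfolding classical_solution_def
  proof (intro exI conjI ballI allI)
    fix z t assume "t \<in> J"
    from d(4)[OF this, of "z + a"] show
      "((\<lambda>s. u (z + a) s) has_real_derivative ut (z + a) t) (at t)"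
      "((\<lambda>y. u (y + a) t) has_real_derivative uz (z + a) t) (at z)"
      "((\<lambda>y. uz (y + a) t) has_real_derivative uzz (z + a) t) (at z)"
      "ut (z + a) t = uzz (z + a) t + f t (u (z + a) t)"
      by (auto simp: DERIV_shift)
  qed (use d(1-3) continuous_on_translate_plane in blast)+
qed

text \<open>The equation holds for positive times, and continuity is asked up to time 0, so that
  comparison can start from the initial data.\<close>

definition bounded_solution ::
    "(real \<Rightarrow> real \<Rightarrow> real) \<Rightarrow> real \<Rightarrow> (real \<Rightarrow> real \<Rightarrow> real) \<Rightarrow> bool" where
  "bounded_solution f M u \<longleftrightarrow> classical_solution f {0<..} u \<and>
     continuous_on (UNIV \<times> {0..}) (\<lambda>(z, t). u z t) \<and> (\<forall>z. \<forall>t\<ge>0. \<bar>u z t\<bar> \<le> M)"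

lemma bounded_solution_translate:
  "bounded_solution f M u \<Longrightarrow> bounded_solution f M (\<lambda>z. u (z + a))"
  unfolding bounded_solution_def
  by (intro conjI classical_solution_translate continuous_on_translate_plane) auto

lemma bounded_solutionD:
  assumes "bounded_solution f M u" "t \<ge> 0"
  shows "\<bar>u z t\<bar> \<le> M"
  using assms by (simp add: bounded_solution_def)

lemma bounded_solution_classical:
  "bounded_solution f M u \<Longrightarrow> classical_solution f {0<..} u"
  by (simp add: bounded_solution_def)

section \<open>Barriers for the difference of two solutions\<close>

text \<open>The maximum principle applied to \<open>u - v - \<kappa>\<close>. Subtracting the two
  equations leaves the difference of the nonlinear terms to estimate, at points where the barrier
  \<open>\<kappa>\<close> is exceeded. Three barriers follow: zero, a decaying exponential in time,
  and one built from a heat kernel.\<close>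

lemma difference_le:
  assumes u: "bounded_solution f M u" and v: "bounded_solution f M v" and "0 \<le> s"
    and cont: "continuous_on (UNIV \<times> {s..T}) (\<lambda>(z, t). \<kappa> z t)"
    and bound: "\<And>z t. s \<le> t \<Longrightarrow> t \<le> T \<Longrightarrow> - C \<le> \<kappa> z t"
    and init: "\<And>z. u z s - v z s \<le> \<kappa> z s"
    and sub: "\<And>z t. s < t \<Longrightarrow> t \<le> T \<Longrightarrow> u z t - v z t > \<kappa> z t \<Longrightarrow>
      \<exists>kt kz kzz. (\<kappa> z has_real_derivative kt) (at t) \<and>
        (\<forall>y. ((\<lambda>y. \<kappa> y t) has_real_derivative kz y) (at y)) \<and>
        (kz has_real_derivative kzz) (at z) \<and>
        f t (u z t) - f t (v z t) - kt \<le> - kzz + B * (u z t - v z t - \<kappa> z t)"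
    and t0: "s \<le> t0" "t0 \<le> T"
  shows "u z0 t0 - v z0 t0 \<le> \<kappa> z0 t0"
proof -
  obtain ut uz uzz where du:
    "\<And>z t. t \<in> {0<..} \<Longrightarrow> (u z has_real_derivative ut z t) (at t)"
    "\<And>z t. t \<in> {0<..} \<Longrightarrow> ((\<lambda>y. u y t) has_real_derivative uz z t) (at z)"
    "\<And>z t. t \<in> {0<..} \<Longrightarrow> ((\<lambda>y. uz y t) has_real_derivative uzz z t) (at z)"
    "\<And>z t. t \<in> {0<..} \<Longrightarrow> ut z t = uzz z t + f t (u z t)"
    by (rule classical_solutionE[OF bounded_solution_classical[OF u]]) (rule that)
  obtain vt vz vzz where dv:
    "\<And>z t. t \<in> {0<..} \<Longrightarrow> (v z has_real_derivative vt z t) (at t)"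
    "\<And>z t. t \<in> {0<..} \<Longrightarrow> ((\<lambda>y. v y t) has_real_derivative vz z t) (at z)"
    "\<And>z t. t \<in> {0<..} \<Longrightarrow> ((\<lambda>y. vz y t) has_real_derivative vzz z t) (at z)"
    "\<And>z t. t \<in> {0<..} \<Longrightarrow> vt z t = vzz z t + f t (v z t)"
    by (rule classical_solutionE[OF bounded_solution_classical[OF v]]) (rule that)
  have c: "continuous_on (UNIV \<times> {s..T}) (\<lambda>(z, t). w z t)"
    if "bounded_solution f M w" for w
    using that \<open>0 \<le> s\<close> unfolding bounded_solution_def
    by (auto elim!: continuous_on_subset)
  have "u z0 t0 - v z0 t0 - \<kappa> z0 t0 \<le> 0"
  proof (rule parabolic_max_principle[where F = "\<lambda>x t. u x t - v x t - \<kappa> x t" and B = B and M = "M + M + C", OF _ _ _ _ t0])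
    show "continuous_on (UNIV \<times> {s..T}) (\<lambda>(x, t). u x t - v x t - \<kappa> x t)"
      using c[OF u] c[OF v] cont unfolding case_prod_beta by (intro continuous_intros)
    show "u x t - v x t - \<kappa> x t \<le> M + M + C" if "s \<le> t" "t \<le> T" for x t
      using bound[OF that, of x] bounded_solutionD[OF u, of t x] bounded_solutionD[OF v, of t x]
        that \<open>0 \<le> s\<close> by auto
    show "u x s - v x s - \<kappa> x s \<le> 0" for x using init[of x] by simp
    fix x t assume t: "s < t" "t \<le> T" and "u x t - v x t - \<kappa> x t > 0"
    then obtain kt kz kzz where k: "(\<kappa> x has_real_derivative kt) (at t)"
        "\<And>y. ((\<lambda>y. \<kappa> y t) has_real_derivative kz y) (at y)"
        "(kz has_real_derivative kzz) (at x)"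
        "f t (u x t) - f t (v x t) - kt \<le> - kzz + B * (u x t - v x t - \<kappa> x t)"
      using sub[of t x] by auto
    have tpos: "t \<in> {0<..}" using t \<open>0 \<le> s\<close> by simp
    show "\<exists>Ft Fx Fxx. ((\<lambda>t. u x t - v x t - \<kappa> x t) has_real_derivative Ft) (at t) \<and>
        (\<forall>x'. ((\<lambda>x. u x t - v x t - \<kappa> x t) has_real_derivative Fx x') (at x')) \<and>
        (Fx has_real_derivative Fxx) (at x) \<and> Ft \<le> Fxx + B * (u x t - v x t - \<kappa> x t)"
    proof (intro exI conjI allI)
      show "((\<lambda>t. u x t - v x t - \<kappa> x t) has_real_derivative ut x t - vt x t - kt) (at t)"
        by (intro DERIV_diff du(1)[OF tpos] dv(1)[OF tpos] k)
      show "((\<lambda>x. u x t - v x t - \<kappa> x t) has_real_derivative uz x' t - vz x' t - kz x') (at x')" for x'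
        by (intro DERIV_diff du(2)[OF tpos] dv(2)[OF tpos] k)
      show "((\<lambda>x'. uz x' t - vz x' t - kz x') has_real_derivative uzz x t - vzz x t - kzz) (at x)"
        by (intro DERIV_diff du(3)[OF tpos] dv(3)[OF tpos] k)
      show "ut x t - vt x t - kt \<le> uzz x t - vzz x t - kzz + B * (u x t - v x t - \<kappa> x t)"
        using k(4) du(4)[OF tpos, of x] dv(4)[OF tpos, of x] by linarith
    qed
  qed
  then show ?thesis by simp
qed

text \<open>Zero barrier: where \<open>u\<close> exceeds \<open>v\<close>, the Lipschitz bound turns
  the nonlinear difference into the linear term of the maximum principle.\<close>

lemma comparison:
  assumes u: "bounded_solution f M u" and v: "bounded_solution f M v" and "0 \<le> s"
    and lip: "\<And>t p q. \<bar>p\<bar> \<le> M \<Longrightarrow> \<bar>q\<bar> \<le> M \<Longrightarrow> \<bar>f t p - f t q\<bar> \<le> B * \<bar>p - q\<bar>"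
    and init: "\<And>z. u z s \<le> v z s"
    and t: "s \<le> t"
  shows "u z t \<le> v z t"
proof -
  have "u z t - v z t \<le> 0"
  proof (rule difference_le[where B = B and \<kappa> = "\<lambda>_ _. 0" and C = 0 and s = s and T = t, OF u v \<open>0 \<le> s\<close>])
    fix z t assume t: "s < t" and "u z t - v z t > 0"
    then have "f t (u z t) - f t (v z t) \<le> B * (u z t - v z t)"
      using lip[of "u z t" "v z t" t] bounded_solutionD[OF u, of t z] bounded_solutionD[OF v, of t z]
        \<open>0 \<le> s\<close> by (auto simp: abs_if split: if_splits)
    then show "\<exists>kt kz kzz. ((\<lambda>_. 0) has_real_derivative kt) (at t) \<and>
        (\<forall>y. ((\<lambda>y. 0) has_real_derivative kz y) (at y)) \<and>
        (kz has_real_derivative kzz) (at z) \<and>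
        f t (u z t) - f t (v z t) - kt \<le> - kzz + B * (u z t - v z t - 0)"
      by (intro exI[of _ 0] exI[of _ "\<lambda>_. 0"]) auto
  qed (use init t in auto)
  then show ?thesis by simp
qed

text \<open>The barrier starts at \<open>k + 2 * M\<close>, above the difference of any two
  functions bounded by \<open>M\<close>, and decays to \<open>k\<close> at rate
  \<open>\<mu>\<close>. Where it is exceeded, the difference is larger than \<open>k\<close>, so the
  dissipation \<open>diss\<close> is available.\<close>

lemma tail_decay:
  assumes u: "bounded_solution f M u" and v: "bounded_solution f M v" and "0 \<le> s" "0 \<le> k"
    and diss: "\<And>z t. s < t \<Longrightarrow> t \<le> T \<Longrightarrow> u z t - v z t > k \<Longrightarrow>
      f t (u z t) - f t (v z t) \<le> - \<mu> * (u z t - v z t)"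
    and "\<mu> > 0" and t: "s \<le> t" "t \<le> T"
  shows "u z t - v z t \<le> k + 2 * M * exp (- \<mu> * (t - s))"
proof -
  have "M \<ge> 0" using bounded_solutionD[OF u, of 0 0] by simp
  show ?thesis
  proof (rule difference_le[where B = 0 and \<kappa> = "\<lambda>_ t. k + 2 * M * exp (- \<mu> * (t - s))"
        and C = 0 and s = s and T = T, OF u v \<open>0 \<le> s\<close>])
    show "continuous_on (UNIV \<times> {s..T}) (\<lambda>(z, t). k + 2 * M * exp (- \<mu> * (t - s)))"
      unfolding case_prod_beta by (intro continuous_intros)
    show "u z s - v z s \<le> k + 2 * M * exp (- \<mu> * (s - s))" for z
      using bounded_solutionD[OF u, of s z] bounded_solutionD[OF v, of s z] \<open>0 \<le> s\<close> \<open>0 \<le> k\<close>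
      by (auto simp: abs_if split: if_splits)
    fix z t assume st: "s < t" "t \<le> T" and gt: "u z t - v z t > k + 2 * M * exp (- \<mu> * (t - s))"
    let ?e = "2 * M * exp (- \<mu> * (t - s))"
    have "?e \<ge> 0" using \<open>M \<ge> 0\<close> by simp
    then have "f t (u z t) - f t (v z t) \<le> - \<mu> * (u z t - v z t)"
      using diss[OF st, of z] gt by linarith
    also have "\<dots> \<le> - \<mu> * ?e"
      using \<open>\<mu> > 0\<close> gt \<open>0 \<le> k\<close> by (simp add: mult_le_cancel_left)
    finally have "f t (u z t) - f t (v z t) \<le> - \<mu> * ?e" .
    moreover have "((\<lambda>t. k + 2 * M * exp (- \<mu> * (t - s))) has_real_derivative - \<mu> * ?e) (at t)"
      by (auto intro!: derivative_eq_intros)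
    ultimately show "\<exists>kt kz kzz. ((\<lambda>t. k + 2 * M * exp (- \<mu> * (t - s))) has_real_derivative kt) (at t) \<and>
        (\<forall>y. ((\<lambda>y. k + 2 * M * exp (- \<mu> * (t - s))) has_real_derivative kz y) (at y)) \<and>
        (kz has_real_derivative kzz) (at z) \<and>
        f t (u z t) - f t (v z t) - kt \<le> - kzz + 0 * (u z t - v z t - (k + ?e))"
      by (intro exI[of _ "- \<mu> * ?e"] exI[of _ 0] exI[of _ "\<lambda>_. 0"]) auto
  qed (use t \<open>M \<ge> 0\<close> \<open>0 \<le> k\<close> in auto)
qed

text \<open>Doubling of variables: \<open>(t - s) (v x t - v y t)\<close> stays below the concave barrier
  \<open>N (2 r - r\<^sup>2)\<close>, \<open>r = \<bar>x - y\<bar>\<close>.\<close>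

lemma solution_lipschitz:
  assumes v: "bounded_solution f M v"
    and K: "\<And>t p. \<bar>p\<bar> \<le> M \<Longrightarrow> \<bar>f t p\<bar> \<le> K"
    and "1 \<le> t"
  shows "\<bar>v x t - v y t\<bar> \<le> 2 * (2 * M + K) * \<bar>x - y\<bar>"
proof -
  have M: "M \<ge> 0" using bounded_solutionD[OF v, of 0 0] by simp
  have K0: "K \<ge> 0" using K[of 0 0] M by simp
  define N where "N = 2 * M + K"
  \<comment> \<open>\<open>N \<ge> 2 * M\<close> lifts the barrier above every difference of values
    at distance 1 or more. In the second inequality, \<open>4 * N\<close> is the contribution of the
    barrier's second derivatives in \<open>x\<close> and \<open>y\<close>; \<open>2 * M\<close> pays
    for differentiating the factor \<open>t - s\<close>, and \<open>2 * K\<close> for the nonlinear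
    terms.\<close>
  have N: "N \<ge> 2 * M" "4 * N \<ge> 2 * M + 2 * K" "N \<ge> 0" using M K0 by (auto simp: N_def)
  \<comment> \<open>The factor \<open>t - s\<close> then vanishes initially and equals 1 at the time
    of interest.\<close>
  define s where "s = t - 1"
  have s: "s \<ge> 0" "t = s + 1" using assms(3) by (auto simp: s_def)
  obtain vt vz vzz where dv:
    "\<And>z t. t \<in> {0<..} \<Longrightarrow> (v z has_real_derivative vt z t) (at t)"
    "\<And>z t. t \<in> {0<..} \<Longrightarrow> ((\<lambda>y. v y t) has_real_derivative vz z t) (at z)"
    "\<And>z t. t \<in> {0<..} \<Longrightarrow> ((\<lambda>y. vz y t) has_real_derivative vzz z t) (at z)"
    "\<And>z t. t \<in> {0<..} \<Longrightarrow> vt z t = vzz z t + f t (v z t)"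
    by (rule classical_solutionE[OF bounded_solution_classical[OF v]]) (rule that)
  define m where "m r = min 1 \<bar>r\<bar>" for r :: real
  define \<psi> where "\<psi> r = N * (2 * m r - (m r)\<^sup>2)" for r
  have \<psi>_ge: "\<psi> r \<ge> N * m r" for r
  proof -
    have "(m r)\<^sup>2 \<le> m r" unfolding power2_eq_square by (rule mult_left_le) (auto simp: m_def)
    then show ?thesis using N unfolding \<psi>_def by (intro mult_left_mono) auto
  qed
  have \<psi>0: "\<psi> r \<ge> 0" for r using \<psi>_ge[of r] N by (smt (verit) mult_nonneg_nonneg m_def abs_ge_zero)
  have \<psi>1: "\<psi> r \<ge> 2 * M" if "\<bar>r\<bar> \<ge> 1" for r using \<psi>_ge[of r] N that by (simp add: m_def)
  have dpsi: "(\<psi> has_real_derivative N * (2 * sgn r - 2 * r)) (at r)"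
    if "0 < \<bar>r\<bar>" "\<bar>r\<bar> < 1" for r
  proof (rule DERIV_cong_ev[THEN iffD2, OF refl _ refl])
    have "\<forall>\<^sub>F q in nhds r. q \<in> ball r (min \<bar>r\<bar> (1 - \<bar>r\<bar>))"
      using that by (intro eventually_nhds_in_open) auto
    then show "\<forall>\<^sub>F q in nhds r. \<psi> q = N * (2 * sgn r * q - q\<^sup>2)"
    proof eventually_elim
      case (elim q)
      then have "m q = sgn r * q" "\<bar>q\<bar> < 1"
        by (auto simp: m_def dist_real_def sgn_if abs_if min_def split: if_splits)
      then show ?case using that by (auto simp: \<psi>_def sgn_if power2_eq_square split: if_splits)
    qed
    show "((\<lambda>q. N * (2 * sgn r * q - q\<^sup>2)) has_real_derivative N * (2 * sgn r - 2 * r)) (at r)"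
      by (auto intro!: derivative_eq_intros)
  qed
  have dsgn: "((\<lambda>r. N * (2 * sgn r - 2 * r)) has_real_derivative - 2 * N) (at r)"
    if "r \<noteq> 0" for r :: real
  proof (rule DERIV_cong_ev[THEN iffD2, OF refl _ refl])
    have "\<forall>\<^sub>F q in nhds r. q \<in> ball r \<bar>r\<bar>"
      using that by (intro eventually_nhds_in_open) auto
    then show "\<forall>\<^sub>F q in nhds r. N * (2 * sgn q - 2 * q) = N * (2 * sgn r - 2 * q)"
      by eventually_elim (auto simp: dist_real_def sgn_if abs_if split: if_splits)
    show "((\<lambda>q. N * (2 * sgn r - 2 * q)) has_real_derivative - 2 * N) (at r)"
      by (auto intro!: derivative_eq_intros)
  qed
  have main: "(t0 - s) * (v x0 t0 - v y0 t0) - \<psi> (x0 - y0) \<le> 0"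
    if t0: "s \<le> t0" "t0 \<le> s + 1" for x0 y0 t0
  proof (rule parabolic_max_principle2[where F = "\<lambda>x y t. (t - s) * (v x t - v y t) - \<psi> (x - y)"
        and B = 0 and M = "2 * M", OF _ _ _ _ t0])
    have c: "continuous_on (UNIV \<times> {0..}) (\<lambda>(z, t). v z t)"
      using v by (simp add: bounded_solution_def)
    have "continuous_on (UNIV \<times> UNIV \<times> {s..s + 1}) ((\<lambda>(z, t). v z t) \<circ> (\<lambda>p. (fst p, snd (snd p))))"
      using s by (intro continuous_on_compose continuous_intros continuous_on_subset[OF c]) auto
    moreover have "continuous_on (UNIV \<times> UNIV \<times> {s..s + 1}) ((\<lambda>(z, t). v z t) \<circ> (\<lambda>p. (fst (snd p), snd (snd p))))"
      using s by (intro continuous_on_compose continuous_intros continuous_on_subset[OF c]) auto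
    ultimately show "continuous_on (UNIV \<times> UNIV \<times> {s..s + 1})
        (\<lambda>(x, y, t). (t - s) * (v x t - v y t) - \<psi> (x - y))"
      unfolding \<psi>_def m_def o_def case_prod_beta fst_conv snd_conv by (intro continuous_intros)
    have vv: "\<bar>v x t - v y t\<bar> \<le> 2 * M" if "s \<le> t" for x y t
      using bounded_solutionD[OF v, of t x] bounded_solutionD[OF v, of t y] that s by auto
    have tvv: "(t - s) * (v x t - v y t) \<le> 2 * M" if "s \<le> t" "t \<le> s + 1" for x y t
    proof -
      have "(t - s) * (v x t - v y t) \<le> (t - s) * (2 * M)"
        using vv[of t x y] that by (intro mult_left_mono) auto
      also have "\<dots> \<le> 1 * (2 * M)" using that M by (intro mult_right_mono) auto
      finally show ?thesis by simp
    qed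
    show "(t - s) * (v x t - v y t) - \<psi> (x - y) \<le> 2 * M" if "s \<le> t" "t \<le> s + 1" for x y t
      using tvv[OF that, of x y] \<psi>0[of "x - y"] by simp
    show "(s - s) * (v x s - v y s) - \<psi> (x - y) \<le> 0" for x y using \<psi>0 by simp
    fix x y t assume t: "s < t" "t \<le> s + 1" and pos: "(t - s) * (v x t - v y t) - \<psi> (x - y) > 0"
    have tpos: "t \<in> {0<..}" using t s by simp
    \<comment> \<open>Where the doubled function is positive, both singular places of the barrier
      are avoided: the kink at distance 0 and the truncation at distance 1.\<close>
    have "x \<noteq> y" using pos \<psi>0[of 0] by auto
    then have xy0: "0 < \<bar>x - y\<bar>" by simp
    have xy1: "\<bar>x - y\<bar> < 1" using pos tvv[of t x y] \<psi>1[of "x - y"] t by force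
    have ev: "\<forall>\<^sub>F x' in nhds x. 0 < \<bar>x' - y\<bar> \<and> \<bar>x' - y\<bar> < 1" if "0 < \<bar>x - y\<bar>" "\<bar>x - y\<bar> < 1" for x y :: real
    proof -
      have "\<forall>\<^sub>F x' in nhds x. x' \<in> ball x (min \<bar>x - y\<bar> (1 - \<bar>x - y\<bar>))"
        using that by (intro eventually_nhds_in_open) auto
      then show ?thesis by eventually_elim (auto simp: dist_real_def abs_if split: if_splits)
    qed
    show "\<exists>Ft Fx Fxx Fy Fyy. ((\<lambda>t. (t - s) * (v x t - v y t) - \<psi> (x - y)) has_real_derivative Ft) (at t) \<and>
        (\<forall>\<^sub>F x' in nhds x. ((\<lambda>x. (t - s) * (v x t - v y t) - \<psi> (x - y)) has_real_derivative Fx x') (at x')) \<and>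
        (Fx has_real_derivative Fxx) (at x) \<and>
        (\<forall>\<^sub>F y' in nhds y. ((\<lambda>y. (t - s) * (v x t - v y t) - \<psi> (x - y)) has_real_derivative Fy y') (at y')) \<and>
        (Fy has_real_derivative Fyy) (at y) \<and>
        Ft \<le> Fxx + Fyy + 0 * ((t - s) * (v x t - v y t) - \<psi> (x - y))"
    proof (intro exI conjI)
      show "((\<lambda>t. (t - s) * (v x t - v y t) - \<psi> (x - y)) has_real_derivative
          (v x t - v y t) + (t - s) * (vt x t - vt y t)) (at t)"
        by (auto intro!: derivative_eq_intros dv(1)[OF tpos] simp: algebra_simps)
      show "\<forall>\<^sub>F x' in nhds x. ((\<lambda>x. (t - s) * (v x t - v y t) - \<psi> (x - y)) has_real_derivative
          (t - s) * vz x' t - N * (2 * sgn (x' - y) - 2 * (x' - y))) (at x')"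
        using ev[OF xy0 xy1]
        by eventually_elim
          (auto intro!: derivative_eq_intros dv(2)[OF tpos] DERIV_chain2[OF dpsi])
      show "\<forall>\<^sub>F y' in nhds y. ((\<lambda>y. (t - s) * (v x t - v y t) - \<psi> (x - y)) has_real_derivative
          - ((t - s) * vz y' t) + N * (2 * sgn (x - y') - 2 * (x - y'))) (at y')"
      proof -
        have "\<forall>\<^sub>F y' in nhds y. 0 < \<bar>y' - x\<bar> \<and> \<bar>y' - x\<bar> < 1" using xy0 xy1 by (intro ev) auto
        then show ?thesis
        proof eventually_elim
          case (elim y')
          then have "((\<lambda>y. \<psi> (x - y)) has_real_derivative N * (2 * sgn (x - y') - 2 * (x - y')) * (0 - 1)) (at y')"
            by (intro DERIV_chain2[OF dpsi] derivative_intros) auto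
          then show ?case by (auto intro!: derivative_eq_intros dv(2)[OF tpos])
        qed
      qed
      show "((\<lambda>x'. (t - s) * vz x' t - N * (2 * sgn (x' - y) - 2 * (x' - y))) has_real_derivative
          (t - s) * vzz x t + 2 * N) (at x)"
      proof -
        have "((\<lambda>x'. N * (2 * sgn (x' - y) - 2 * (x' - y))) has_real_derivative - 2 * N * (1 - 0)) (at x)"
          using xy0 by (intro DERIV_chain2[OF dsgn] derivative_intros) auto
        from DERIV_diff[OF DERIV_cmult[OF dv(3)[OF tpos, of x], of "t - s"] this] show ?thesis
          by simp
      qed
      show "((\<lambda>y'. - ((t - s) * vz y' t) + N * (2 * sgn (x - y') - 2 * (x - y'))) has_real_derivative
          - ((t - s) * vzz y t) + 2 * N) (at y)"
      proof -
        have "((\<lambda>y'. N * (2 * sgn (x - y') - 2 * (x - y'))) has_real_derivative - 2 * N * (0 - 1)) (at y)"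
          using xy0 by (intro DERIV_chain2[OF dsgn] derivative_intros) auto
        from DERIV_add[OF DERIV_minus[OF DERIV_cmult[OF dv(3)[OF tpos, of y], of "t - s"]] this]
        show ?thesis by simp
      qed
      have "(t - s) * (f t (v x t) - f t (v y t)) \<le> (t - s) * (2 * K)"
        using K[of "v x t" t] K[of "v y t" t] bounded_solutionD[OF v, of t x]
          bounded_solutionD[OF v, of t y] t s by (intro mult_left_mono) (auto simp: abs_le_iff)
      also have "\<dots> \<le> 1 * (2 * K)" using t K0 by (intro mult_right_mono) auto
      finally have "(t - s) * (f t (v x t) - f t (v y t)) \<le> 2 * K" by simp
      moreover have "vt x t = vzz x t + f t (v x t)" "vt y t = vzz y t + f t (v y t)"
        using dv(4)[OF tpos] by auto
      ultimately show "(v x t - v y t) + (t - s) * (vt x t - vt y t) \<le>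
          (t - s) * vzz x t + 2 * N + (- ((t - s) * vzz y t) + 2 * N) +
          0 * ((t - s) * (v x t - v y t) - \<psi> (x - y))"
        using vv[of t x y] t N by (simp add: algebra_simps)
    qed
  qed
  have \<psi>_le: "\<psi> r \<le> 2 * N * \<bar>r\<bar>" for r
  proof -
    have "2 * m r - (m r)\<^sup>2 \<le> 2 * \<bar>r\<bar>"
      using zero_le_power2[of "m r"] min.cobounded2[of 1 "\<bar>r\<bar>"] unfolding m_def by linarith
    then have "N * (2 * m r - (m r)\<^sup>2) \<le> N * (2 * \<bar>r\<bar>)" using N by (intro mult_left_mono) auto
    then show ?thesis by (simp add: \<psi>_def)
  qed
  have "\<bar>v x t - v y t\<bar> \<le> 2 * N * \<bar>x - y\<bar>"
  proof -
    have "v x t - v y t \<le> \<psi> (x - y)" "v y t - v x t \<le> \<psi> (y - x)"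
      using main[of t x y] main[of t y x] s by simp_all
    then show ?thesis
      using \<psi>_le[of "x - y"] \<psi>_le[of "y - x", unfolded abs_minus_commute[of y x]] by linarith
  qed
  then show ?thesis by (simp add: N_def)
qed

section \<open>Propagation of positivity by a heat kernel\<close>

text \<open>The bracket is a multiple of the heat kernel, started at age \<open>\<theta>\<close>
  with peak value 1, minus the constant that makes it nonpositive initially outside
  \<open>[-r, r]\<close>. For small \<open>\<theta>\<close> the kernel at times in
  \<open>[1, D]\<close> is of order \<open>sqrt \<theta>\<close>, while the subtracted constant is
  far smaller, so the difference is bounded below by a positive number.\<close>

lemma gaussian_lower_bound:
  fixes r \<rho> k D :: real
  assumes "k > 0" "r > 0" "D \<ge> 1"
  obtains \<theta> m where "\<theta> > 0" "m > 0"
    "\<And>x t. 1 \<le> t \<Longrightarrow> t \<le> D \<Longrightarrow> \<bar>x\<bar> \<le> \<rho> \<Longrightarrow>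
      m \<le> k * (sqrt \<theta> * (exp (- x\<^sup>2 / (4 * (t + \<theta>))) / sqrt (t + \<theta>)) - exp (- r\<^sup>2 / (4 * \<theta>)))"
proof -
  define A where "A = exp (- \<rho>\<^sup>2 / 4) / sqrt (D + 1)"
  have A: "A > 0" using assms by (simp add: A_def)
  \<comment> \<open>\<open>q\<close> will be \<open>sqrt \<theta>\<close>. The kernel term is at
    least \<open>q * A\<close>, and the bound on \<open>q\<close> makes the subtracted constant at
    most half of that.\<close>
  define q where "q = min 1 (A * r\<^sup>2 / 8)"
  have q: "0 < q" "q \<le> 1" "q \<le> A * r\<^sup>2 / 8" using A assms by (auto simp: q_def)
  define \<theta> where "\<theta> = q\<^sup>2"
  have \<theta>: "0 < \<theta>" "\<theta> \<le> 1" "sqrt \<theta> = q" using q by (auto simp: \<theta>_def power_le_one)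
  have "exp (- r\<^sup>2 / (4 * \<theta>)) \<le> 4 * \<theta> / r\<^sup>2"
  proof -
    have "r\<^sup>2 / (4 * \<theta>) \<le> exp (r\<^sup>2 / (4 * \<theta>))" using exp_ge_add_one_self[of "r\<^sup>2 / (4 * \<theta>)"] by linarith
    then have "inverse (exp (r\<^sup>2 / (4 * \<theta>))) \<le> inverse (r\<^sup>2 / (4 * \<theta>))"
      using assms \<theta> by (intro le_imp_inverse_le) auto
    then show ?thesis by (simp add: exp_minus)
  qed
  also have "\<dots> = q * (4 * q / r\<^sup>2)" by (simp add: \<theta>_def power2_eq_square)
  also have "\<dots> \<le> q * (A / 2)"
    using q assms by (intro mult_left_mono) (auto simp: field_simps)
  finally have small: "exp (- r\<^sup>2 / (4 * \<theta>)) \<le> q * (A / 2)" .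
  show ?thesis
  proof (rule that[of \<theta> "k * (q * (A / 2))"])
    show "k * (q * (A / 2)) > 0" using assms q A by simp
    fix x t :: real assume t: "1 \<le> t" "t \<le> D" and x: "\<bar>x\<bar> \<le> \<rho>"
    have "x\<^sup>2 \<le> \<rho>\<^sup>2" using x abs_le_square_iff[of x \<rho>] by simp
    then have "x\<^sup>2 / (4 * (t + \<theta>)) \<le> \<rho>\<^sup>2 / 4"
      using t \<theta> by (intro frac_le) auto
    then have "exp (- \<rho>\<^sup>2 / 4) \<le> exp (- x\<^sup>2 / (4 * (t + \<theta>)))" by simp
    moreover have "sqrt (t + \<theta>) \<le> sqrt (D + 1)" using t \<theta> by simp
    ultimately have "A \<le> exp (- x\<^sup>2 / (4 * (t + \<theta>))) / sqrt (t + \<theta>)"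
      unfolding A_def using t \<theta> by (intro frac_le) auto
    then have "q * A \<le> q * (exp (- x\<^sup>2 / (4 * (t + \<theta>))) / sqrt (t + \<theta>))"
      using q by (intro mult_left_mono) auto
    then show "k * (q * (A / 2)) \<le>
        k * (sqrt \<theta> * (exp (- x\<^sup>2 / (4 * (t + \<theta>))) / sqrt (t + \<theta>)) - exp (- r\<^sup>2 / (4 * \<theta>)))"
      using small \<theta> assms by (intro mult_left_mono) (auto simp: algebra_simps)
  qed (use \<theta> in auto)
qed

text \<open>A gap of size \<open>k\<close> on an interval around \<open>y\<close> dominates a
  Gaussian subsolution, which is positive everywhere within distance \<open>\<rho>\<close> one unit
  of time later. The constant \<open>m\<close> is uniform in the times, in \<open>y\<close> and in
  \<open>\<eta>\<close>, so \<open>\<eta>\<close> can afterwards be chosen small against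
  \<open>m\<close>.\<close>

lemma spreading:
  assumes u: "bounded_solution f M u" and v: "bounded_solution f M v"
    and lip: "\<forall>t p q. \<bar>p\<bar> \<le> M \<longrightarrow> \<bar>q\<bar> \<le> M \<longrightarrow> \<bar>f t p - f t q\<bar> \<le> B * \<bar>p - q\<bar>"
    and "B \<ge> 0" "k > 0" "r > 0" "D \<ge> 1"
  shows "\<exists>m>0. \<forall>s t \<eta> y z. 0 \<le> s \<longrightarrow> s + 1 \<le> t \<longrightarrow> t \<le> s + D \<longrightarrow> \<bar>z - y\<bar> \<le> \<rho> \<longrightarrow> \<eta> \<ge> 0 \<longrightarrow>
      (\<forall>z t'. s \<le> t' \<longrightarrow> t' \<le> t \<longrightarrow> u z t' - v z t' \<le> \<eta>) \<longrightarrow>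
      (\<forall>z. \<bar>z - y\<bar> \<le> r \<longrightarrow> k \<le> v z s - u z s) \<longrightarrow>
      m - \<eta> * exp (B * D) \<le> v z t - u z t"
proof -
  obtain \<theta> m where \<theta>: "\<theta> > 0" "m > 0"
    "\<And>x t. 1 \<le> t \<Longrightarrow> t \<le> D \<Longrightarrow> \<bar>x\<bar> \<le> \<rho> \<Longrightarrow>
      m \<le> k * (sqrt \<theta> * (exp (- x\<^sup>2 / (4 * (t + \<theta>))) / sqrt (t + \<theta>)) - exp (- r\<^sup>2 / (4 * \<theta>)))"
    using gaussian_lower_bound assms by metis
  show ?thesis
  proof (intro exI[of _ "exp (- B * D) * m"] conjI allI impI)
    show "exp (- B * D) * m > 0" using \<theta> by simp
    fix s t \<eta> y z :: real
    assume st: "0 \<le> s" "s + 1 \<le> t" "t \<le> s + D" and zy: "\<bar>z - y\<bar> \<le> \<rho>" and \<eta>: "\<eta> \<ge> 0"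
      and "\<forall>z t'. s \<le> t' \<longrightarrow> t' \<le> t \<longrightarrow> u z t' - v z t' \<le> \<eta>"
      and "\<forall>z. \<bar>z - y\<bar> \<le> r \<longrightarrow> k \<le> v z s - u z s"
    then have low: "\<And>z t'. s \<le> t' \<Longrightarrow> t' \<le> t \<Longrightarrow> u z t' - v z t' \<le> \<eta>"
      and init: "\<And>z. \<bar>z - y\<bar> \<le> r \<Longrightarrow> k \<le> v z s - u z s" by auto
    define g where "g x T = exp (- x\<^sup>2 / (4 * T)) / sqrt T" for x T :: real
    \<comment> \<open>\<open>S\<close> solves the heat equation, is at most \<open>k\<close>, and is
      nonpositive at time \<open>s\<close> outside the interval of radius \<open>r\<close> around
      \<open>y\<close>.\<close>
    define S where "S x t = k * (sqrt \<theta> * g (x - y) (t - s + \<theta>) - exp (- r\<^sup>2 / (4 * \<theta>)))" for x t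
    \<comment> \<open>The nonlinear term costs at most a factor \<open>exp (B * (t - s))\<close> on
      either side: it may amplify the defect \<open>\<eta>\<close> and damp the Gaussian.\<close>
    define \<kappa> where "\<kappa> x t = \<eta> * exp (B * (t - s)) - exp (- B * (t - s)) * S x t" for x t
    \<comment> \<open>With this factor both the time derivative and the second space derivative of
      \<open>g\<close> equal \<open>h * g\<close>, which is the heat equation.\<close>
    define h where "h x T = x\<^sup>2 / (4 * T\<^sup>2) - 1 / (2 * T)" for x T :: real
    have gt: "(g x has_real_derivative h x T * g x T) (at T)" if "T > 0" for x T
      unfolding g_def h_def using that
      by (auto intro!: derivative_eq_intros simp: field_simps power2_eq_square)
    have gx: "((\<lambda>x. g x T) has_real_derivative - x / (2 * T) * g x T) (at x)" if "T > 0" for x T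
      unfolding g_def using that by (auto intro!: derivative_eq_intros simp: field_simps)
    have gxx: "((\<lambda>x. - x / (2 * T) * g x T) has_real_derivative h x T * g x T) (at x)" if "T > 0" for x T
      unfolding h_def using that
      by (auto intro!: derivative_eq_intros gx[OF that] simp: field_simps power2_eq_square)
    have S_le: "S x t' \<le> k" if "s \<le> t'" for x t'
    proof -
      have "g (x - y) (t' - s + \<theta>) \<le> 1 / sqrt \<theta>"
        unfolding g_def using that \<theta> by (intro frac_le) (auto simp: divide_nonpos_pos)
      then have "sqrt \<theta> * g (x - y) (t' - s + \<theta>) \<le> 1" using \<theta> by (simp add: field_simps)
      then have "sqrt \<theta> * g (x - y) (t' - s + \<theta>) - exp (- r\<^sup>2 / (4 * \<theta>)) \<le> 1"
        using exp_gt_zero[of "- r\<^sup>2 / (4 * \<theta>)"] by linarith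
      then have "S x t' \<le> k * 1" unfolding S_def using \<open>k > 0\<close> by (intro mult_left_mono) auto
      then show ?thesis by simp
    qed
    have "u z t - v z t \<le> \<kappa> z t"
    proof (rule difference_le[where B = 0 and C = k and s = s and T = t, OF u v st(1)])
      show "continuous_on (UNIV \<times> {s..t}) (\<lambda>(z, t). \<kappa> z t)"
        unfolding \<kappa>_def S_def g_def case_prod_beta using \<theta>
        by (intro continuous_intros) (auto simp: add_nonneg_eq_0_iff)
      show "- k \<le> \<kappa> x t'" if "s \<le> t'" "t' \<le> t" for x t'
      proof -
        have "exp (- B * (t' - s)) * S x t' \<le> exp (- B * (t' - s)) * k"
          using S_le[OF that(1), of x] by (intro mult_left_mono) auto
        also have "\<dots> \<le> 1 * k" using \<open>B \<ge> 0\<close> \<open>k > 0\<close> that by (intro mult_right_mono) auto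
        finally show ?thesis using mult_nonneg_nonneg[OF \<eta>, of "exp (B * (t' - s))"]
          unfolding \<kappa>_def by simp
      qed
      show "u x s - v x s \<le> \<kappa> x s" for x
      proof (cases "\<bar>x - y\<bar> \<le> r")
        case True
        then show ?thesis using init[OF True] S_le[of s x] \<eta> by (simp add: \<kappa>_def)
      next
        case False
        then have "r\<^sup>2 \<le> (x - y)\<^sup>2" using abs_le_square_iff[of r "x - y"] \<open>r > 0\<close> by simp
        then have "exp (- (x - y)\<^sup>2 / (4 * \<theta>)) \<le> exp (- r\<^sup>2 / (4 * \<theta>))"
          using \<theta> by (simp add: divide_right_mono)
        then have "S x s \<le> 0" using \<theta> \<open>k > 0\<close> by (simp add: S_def g_def mult_nonneg_nonpos)
        then show ?thesis using low[of s x] st by (simp add: \<kappa>_def)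
      qed
      fix x t' assume t': "s < t'" "t' \<le> t" and gt': "u x t' - v x t' > \<kappa> x t'"
      define T where "T = t' - s + \<theta>"
      have T: "T > 0" using t' \<theta> by (simp add: T_def)
      define e where "e = exp (- B * (t' - s))"
      define E where "E = exp (B * (t' - s))"
      define G where "G = k * sqrt \<theta> * (h (x - y) T * g (x - y) T)"
      have St: "(S x has_real_derivative G) (at t')"
      proof -
        have "((\<lambda>t. g (x - y) (t - s + \<theta>)) has_real_derivative h (x - y) T * g (x - y) T * (1 - 0 + 0)) (at t')"
          unfolding T_def
          by (intro DERIV_chain2[OF gt] derivative_intros) (use T in \<open>simp_all add: T_def\<close>)
        then show ?thesis unfolding S_def G_def by (auto intro!: derivative_eq_intros)
      qed
      have "((\<lambda>t. \<kappa> x t) has_real_derivative B * \<eta> * E + B * e * S x t' - e * G) (at t')"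
        unfolding \<kappa>_def E_def e_def by (auto intro!: derivative_eq_intros St simp: algebra_simps)
      moreover have "((\<lambda>x. \<kappa> x t') has_real_derivative - (e * (k * sqrt \<theta>)) * (- (x' - y) / (2 * T) * g (x' - y) T)) (at x')" for x'
      proof -
        have "((\<lambda>x. g (x - y) T) has_real_derivative - (x' - y) / (2 * T) * g (x' - y) T * (1 - 0)) (at x')"
          using T by (intro DERIV_chain2[OF gx] derivative_intros) auto
        then show ?thesis unfolding \<kappa>_def S_def e_def[symmetric] T_def[symmetric]
          by (auto intro!: derivative_eq_intros)
      qed
      moreover have "((\<lambda>x'. - (e * (k * sqrt \<theta>)) * (- (x' - y) / (2 * T) * g (x' - y) T)) has_real_derivative - (e * G)) (at x)"
      proof -
        have "((\<lambda>x. - (x - y) / (2 * T) * g (x - y) T) has_real_derivative h (x - y) T * g (x - y) T * (1 - 0)) (at x)"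
          using T by (intro DERIV_chain2[OF gxx] derivative_intros) auto
        from DERIV_cmult[OF this, of "- (e * (k * sqrt \<theta>))"] show ?thesis
          by (rule DERIV_cong) (simp add: G_def)
      qed
      moreover have "f t' (u x t') - f t' (v x t') \<le> B * \<eta> * E + B * e * S x t'"
      proof -
        define w where "w = v x t' - u x t'"
        have w: "- \<eta> \<le> w" using low[of t' x] t' by (simp add: w_def)
        have "w < e * S x t' - \<eta> * E" using gt' by (simp add: w_def \<kappa>_def e_def E_def)
        moreover have "\<eta> \<le> \<eta> * E" using \<eta> \<open>B \<ge> 0\<close> t' by (simp add: E_def mult_le_cancel_left1)
        \<comment> \<open>The two bounds on \<open>w\<close> together force
          \<open>e * S x t'\<close> to be positive, which also settles the case of negative
          \<open>w\<close>.\<close>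
        ultimately have "\<bar>w\<bar> \<le> \<eta> * E + e * S x t'" using w \<eta> by auto
        then have "B * \<bar>w\<bar> \<le> B * (\<eta> * E + e * S x t')" using \<open>B \<ge> 0\<close> by (intro mult_left_mono)
        moreover have "\<bar>f t' (u x t') - f t' (v x t')\<bar> \<le> B * \<bar>u x t' - v x t'\<bar>"
          using bounded_solutionD[OF u, of t' x] bounded_solutionD[OF v, of t' x] t' st by (intro lip[rule_format]) auto
        ultimately show ?thesis by (simp add: w_def abs_minus_commute algebra_simps)
      qed
      ultimately show "\<exists>kt kz kzz. (\<kappa> x has_real_derivative kt) (at t') \<and>
        (\<forall>y. ((\<lambda>y. \<kappa> y t') has_real_derivative kz y) (at y)) \<and>
        (kz has_real_derivative kzz) (at x) \<and>
        f t' (u x t') - f t' (v x t') - kt \<le> - kzz + 0 * (u x t' - v x t' - \<kappa> x t')"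
        by (intro exI[of _ "B * \<eta> * E + B * e * S x t' - e * G"] exI[of _ "- (e * G)"]
            exI[of _ "\<lambda>x'. - (e * (k * sqrt \<theta>)) * (- (x' - y) / (2 * T) * g (x' - y) T)"]) auto
    qed (use st in auto)
    moreover have "exp (- B * D) * m \<le> exp (- B * (t - s)) * S z t"
      unfolding S_def g_def using st zy \<theta> \<open>B \<ge> 0\<close>
      by (intro mult_mono \<theta>(3)) (auto simp: mult_left_mono)
    moreover have "\<eta> * exp (B * (t - s)) \<le> \<eta> * exp (B * D)"
      using \<eta> \<open>B \<ge> 0\<close> st by (intro mult_left_mono) (auto simp: mult_left_mono)
    ultimately show "exp (- B * D) * m - \<eta> * exp (B * D) \<le> v z t - u z t"
      by (simp add: \<kappa>_def)
  qed
qed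

section \<open>Sliding a wave below a perturbation of it\<close>

lemma exp_decay_time:
  fixes \<mu> \<eta> M :: real
  assumes "\<mu> > 0" "\<eta> > 0" "M \<ge> 0"
  obtains \<tau> where "\<tau> \<ge> 0" "\<And>t. t \<ge> \<tau> \<Longrightarrow> 2 * M * exp (- \<mu> * t) \<le> \<eta>"
proof (rule that[of "2 * M / (\<mu> * \<eta>)"])
  fix t assume "2 * M / (\<mu> * \<eta>) \<le> t"
  then have "2 * M \<le> \<eta> * (\<mu> * t)" using assms by (simp add: field_simps)
  also have "\<dots> \<le> \<eta> * exp (\<mu> * t)"
    using exp_ge_add_one_self[of "\<mu> * t"] assms by (intro mult_left_mono) linarith+
  finally show "2 * M * exp (- \<mu> * t) \<le> \<eta>" by (simp add: exp_minus field_simps)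
qed (use assms in auto)

text \<open>In the application \<open>W\<close> is the wave in the fixed frame and \<open>V\<close>
  the perturbed solution. The bound \<open>speed\<close> limits the drift of the tube around
  \<open>c t\<close>. In \<open>tails\<close> the product form covers both orderings of
  \<open>W\<close> and \<open>V\<close> at once, and \<open>R\<close> may depend on the largest
  shift \<open>a\<close>.\<close>

locale sliding =
  fixes f W V :: "real \<Rightarrow> real \<Rightarrow> real" and c :: "real \<Rightarrow> real" and M K B \<mu> C :: real
  assumes W: "bounded_solution f M W" and V: "bounded_solution f M V"
    and lip: "\<And>t p q. \<bar>p\<bar> \<le> M \<Longrightarrow> \<bar>q\<bar> \<le> M \<Longrightarrow> \<bar>f t p - f t q\<bar> \<le> B * \<bar>p - q\<bar>"
    and f_bound: "\<And>t p. \<bar>p\<bar> \<le> M \<Longrightarrow> \<bar>f t p\<bar> \<le> K"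
    and B: "B \<ge> 0" and \<mu>: "\<mu> > 0"
    and speed: "\<And>s t. \<bar>c t - c s\<bar> \<le> C * \<bar>t - s\<bar>"
    and tails: "\<And>a. \<exists>R. \<forall>b z t. 0 \<le> b \<longrightarrow> b \<le> a \<longrightarrow> 0 \<le> t \<longrightarrow> R \<le> \<bar>z - c t\<bar> \<longrightarrow>
      (W (z + b) t - V z t) * (f t (W (z + b) t) - f t (V z t)) \<le> - \<mu> * (W (z + b) t - V z t)\<^sup>2"
begin

text \<open>Allowing an error \<open>\<eta>\<close> after a late time makes the property survive a
  limit in \<open>a\<close>. Quantifying over all shifts up to \<open>a\<close> makes it downward
  closed and provides the intermediate shifts from which monotonicity is read off.\<close>

definition below :: "real \<Rightarrow> bool" where
  "below a \<longleftrightarrow> (\<forall>\<eta>>0. \<exists>T\<ge>0. \<forall>b t z. 0 \<le> b \<longrightarrow> b \<le> a \<longrightarrow> T \<le> t \<longrightarrow> W (z + b) t \<le> V z t + \<eta>)"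

definition dissipative_outside :: "real \<Rightarrow> real \<Rightarrow> bool" where
  "dissipative_outside R a \<longleftrightarrow> (\<forall>b z t. 0 \<le> b \<longrightarrow> b \<le> a \<longrightarrow> 0 \<le> t \<longrightarrow> R \<le> \<bar>z - c t\<bar> \<longrightarrow>
    (W (z + b) t - V z t) * (f t (W (z + b) t) - f t (V z t)) \<le> - \<mu> * (W (z + b) t - V z t)\<^sup>2)"

definition "L = 2 * (2 * M + K)"

lemma M_nonneg: "M \<ge> 0"
  using bounded_solutionD[OF W, of 0 0] by simp

lemma L_nonneg: "L \<ge> 0"
  using f_bound[of 0 0] M_nonneg by (simp add: L_def)

lemma W_lipschitz: "1 \<le> t \<Longrightarrow> \<bar>W x t - W y t\<bar> \<le> L * \<bar>x - y\<bar>"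
  unfolding L_def by (rule solution_lipschitz[OF W f_bound])

lemma V_lipschitz: "1 \<le> t \<Longrightarrow> \<bar>V x t - V y t\<bar> \<le> L * \<bar>x - y\<bar>"
  unfolding L_def by (rule solution_lipschitz[OF V f_bound])

lemma below_antimono: "below a \<Longrightarrow> a' \<le> a \<Longrightarrow> below a'"
  unfolding below_def by (metis order_trans)

lemma dissipativeD:
  assumes "dissipative_outside R a" "0 \<le> b" "b \<le> a" "0 \<le> t" "R \<le> \<bar>z - c t\<bar>"
  shows "W (z + b) t - V z t > 0 \<Longrightarrow>
      f t (W (z + b) t) - f t (V z t) \<le> - \<mu> * (W (z + b) t - V z t)"
    and "V z t - W (z + b) t > 0 \<Longrightarrow>
      f t (V z t) - f t (W (z + b) t) \<le> - \<mu> * (V z t - W (z + b) t)"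
proof -
  define d g where "d = W (z + b) t - V z t" and "g = f t (W (z + b) t) - f t (V z t)"
  have dg: "d * g \<le> d * (- \<mu> * d)"
    using assms unfolding dissipative_outside_def d_def g_def by (simp add: power2_eq_square algebra_simps)
  have "g \<le> - \<mu> * d" if "d > 0" by (rule mult_left_le_imp_le[OF dg that])
  then show "W (z + b) t - V z t > 0 \<Longrightarrow>
      f t (W (z + b) t) - f t (V z t) \<le> - \<mu> * (W (z + b) t - V z t)" by (simp add: d_def g_def)
  have "- \<mu> * d \<le> g" if "d < 0" using dg mult_le_cancel_left_neg[OF that] by blast
  then show "V z t - W (z + b) t > 0 \<Longrightarrow>
      f t (V z t) - f t (W (z + b) t) \<le> - \<mu> * (V z t - W (z + b) t)"
    by (simp add: d_def g_def algebra_simps)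
qed

text \<open>\<open>W\<close> is Lipschitz in space uniformly for times at least 1, so replacing a
  shift in \<open>[a', a]\<close> by \<open>a'\<close> costs at most
  \<open>L * e \<le> \<eta> / 2\<close>.\<close>

lemma below_closed:
  assumes "0 < a" and less: "\<And>a'. a' < a \<Longrightarrow> below a'"
  shows "below a"
  unfolding below_def
proof (intro allI impI)
  fix \<eta> :: real assume \<eta>: "\<eta> > 0"
  define e where "e = \<eta> / (2 * (L + 1))"
  have e: "e > 0" "L * e \<le> \<eta> / 2" using \<eta> L_nonneg by (auto simp: e_def field_simps)
  define a' where "a' = max 0 (a - e)"
  have a': "0 \<le> a'" "a' < a" "a - e \<le> a'" using assms(1) e by (auto simp: a'_def)
  obtain T where T: "T \<ge> 0" "\<And>b t z. 0 \<le> b \<Longrightarrow> b \<le> a' \<Longrightarrow> T \<le> t \<Longrightarrow> W (z + b) t \<le> V z t + \<eta> / 2"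
    using less[OF a'(2)] \<eta> unfolding below_def by (metis half_gt_zero)
  show "\<exists>T\<ge>0. \<forall>b t z. 0 \<le> b \<longrightarrow> b \<le> a \<longrightarrow> T \<le> t \<longrightarrow> W (z + b) t \<le> V z t + \<eta>"
  proof (intro exI[of _ "max T 1"] conjI allI impI)
    fix b t z assume b: "0 \<le> b" "b \<le> a" and t: "max T 1 \<le> t"
    show "W (z + b) t \<le> V z t + \<eta>"
    proof (cases "b \<le> a'")
      case True
      then show ?thesis using T(2)[of b t z] b t \<eta> by simp
    next
      case False
      have "W (z + b) t - W (z + a') t \<le> L * \<bar>(z + b) - (z + a')\<bar>"
        using W_lipschitz[of t "z + b" "z + a'"] t by simp
      also have "\<dots> \<le> L * e" using False b a' L_nonneg by (intro mult_left_mono) auto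
      finally show ?thesis using T(2)[of a' t z] a' t e by simp
    qed
  qed simp
qed

text \<open>Inside the tube the gap \<open>m\<close> absorbs an extra shift \<open>h\<close> with
  \<open>L * h \<le> m\<close>. Hence \<open>W (z + b) t\<close> can exceed \<open>V z t\<close>
  only outside the tube, where dissipation makes the excess decay exponentially.\<close>

lemma below_extend:
  assumes a: "0 \<le> a" "below a" and R: "dissipative_outside R (a + 1)" and "m > 0" "T0 \<ge> 0"
    and tube: "\<And>t z. T0 \<le> t \<Longrightarrow> \<bar>z - c t\<bar> \<le> R \<Longrightarrow> W (z + a) t + m \<le> V z t"
  shows "\<exists>h>0. below (a + h)"
proof -
  \<comment> \<open>The cap 1 keeps all shifts within the range \<open>a + 1\<close> for which
    \<open>R\<close> was chosen.\<close>
  define h where "h = min 1 (m / (L + 1))"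
  have h: "h > 0" "h \<le> 1" using \<open>m > 0\<close> L_nonneg by (auto simp: h_def)
  have "L * h \<le> L * (m / (L + 1))" using L_nonneg by (intro mult_left_mono) (auto simp: h_def)
  also have "\<dots> \<le> m" using L_nonneg \<open>m > 0\<close> by (simp add: field_simps)
  finally have Lh: "L * h \<le> m" .
  define T1 where "T1 = max T0 1"
  have decay: "W (z + b) t - V z t \<le> 0 + 2 * M * exp (- \<mu> * (t - T1))"
    if b: "a \<le> b" "b \<le> a + h" and t: "T1 \<le> t" for b t z
  proof (rule tail_decay[OF bounded_solution_translate[OF W, of b] V _ _ _ \<mu> t, where T = t])
    fix z t assume t: "T1 < t" and pos: "W (z + b) t - V z t > 0"
    have "R < \<bar>z - c t\<bar>"
    proof (rule ccontr)
      assume "\<not> R < \<bar>z - c t\<bar>"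
      then have "W (z + a) t + m \<le> V z t" using tube t by (simp add: T1_def)
      moreover have "W (z + b) t - W (z + a) t \<le> L * \<bar>(z + b) - (z + a)\<bar>"
        using W_lipschitz[of t "z + b" "z + a"] t by (simp add: T1_def)
      moreover have "L * \<bar>(z + b) - (z + a)\<bar> \<le> L * h"
        using b L_nonneg by (intro mult_left_mono) auto
      ultimately show False using pos Lh by linarith
    qed
    then show "f t (W (z + b) t) - f t (V z t) \<le> - \<mu> * (W (z + b) t - V z t)"
      using dissipativeD(1)[OF R, of b t z] pos b a h t by (simp add: T1_def)
  qed (use \<open>T0 \<ge> 0\<close> in \<open>auto simp: T1_def\<close>)
  have "below (a + h)"
    unfolding below_def
  proof (intro allI impI)
    fix \<eta> :: real assume \<eta>: "\<eta> > 0"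
    obtain T where T: "T \<ge> 0" "\<And>b t z. 0 \<le> b \<Longrightarrow> b \<le> a \<Longrightarrow> T \<le> t \<Longrightarrow> W (z + b) t \<le> V z t + \<eta>"
      using a(2) \<eta> unfolding below_def by metis
    obtain \<tau> where \<tau>: "\<tau> \<ge> 0" "\<And>t. t \<ge> \<tau> \<Longrightarrow> 2 * M * exp (- \<mu> * t) \<le> \<eta>"
      using exp_decay_time[OF \<mu> \<eta> M_nonneg] by blast
    show "\<exists>T\<ge>0. \<forall>b t z. 0 \<le> b \<longrightarrow> b \<le> a + h \<longrightarrow> T \<le> t \<longrightarrow> W (z + b) t \<le> V z t + \<eta>"
    proof (intro exI[of _ "max T (T1 + \<tau>)"] conjI allI impI)
      fix b t z assume b: "0 \<le> b" "b \<le> a + h" and t: "max T (T1 + \<tau>) \<le> t"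
      show "W (z + b) t \<le> V z t + \<eta>"
      proof (cases "b \<le> a")
        case True
        then show ?thesis using T(2)[of b t z] b t by simp
      next
        case False
        then show ?thesis using decay[of b t z] \<tau>(2)[of "t - T1"] \<tau>(1) b t by simp
      qed
    qed (use T in simp)
  qed
  then show ?thesis using h by blast
qed

text \<open>By \<open>tail_decay\<close>, a gap small throughout the tube over a long time window
  would be small everywhere at its end, against \<open>far\<close>. So every late window contains a
  point of the tube with a large gap, and \<open>spreading\<close> carries it to the whole tube with
  a uniform constant.\<close>

lemma tube_positive:
  assumes a: "0 \<le> a" "below a" and R: "dissipative_outside R a" and \<kappa>: "\<kappa> > 0"
    and far: "\<And>s. T \<le> s \<Longrightarrow> \<exists>z. \<kappa> < \<bar>V z s - W (z + a) s\<bar>"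
  obtains m T0 where "m > 0" "T0 \<ge> 0"
    "\<And>t z. T0 \<le> t \<Longrightarrow> \<bar>z - c t\<bar> \<le> R \<Longrightarrow> W (z + a) t + m \<le> V z t"
proof -
  note Wa = bounded_solution_translate[OF W, of a]
  \<comment> \<open>After time \<open>\<tau>\<close> the decaying part is below
    \<open>\<kappa> / 4\<close>, so a gap at most \<open>\<kappa> / 2\<close> in the tube would give
    less than \<open>\<kappa>\<close> everywhere.\<close>
  obtain \<tau> where \<tau>: "\<tau> \<ge> 0" "\<And>t. t \<ge> \<tau> \<Longrightarrow> 2 * M * exp (- \<mu> * t) \<le> \<kappa> / 4"
    using exp_decay_time[OF \<mu>, of "\<kappa> / 4" M] \<kappa> M_nonneg by auto
  have below: "\<exists>T\<ge>0. \<forall>t z. T \<le> t \<longrightarrow> W (z + a) t \<le> V z t + \<eta>" if "\<eta> > 0" for \<eta>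
    using a that unfolding below_def by (meson order_refl)
  obtain T' where T': "\<And>t z. T' \<le> t \<Longrightarrow> W (z + a) t \<le> V z t + \<kappa> / 2"
    using below[of "\<kappa> / 2"] \<kappa> by auto
  define T1 where "T1 = max (max T T') 1"
  have T1: "T \<le> T1" "T' \<le> T1" "1 \<le> T1" by (auto simp: T1_def)
  have large: "\<exists>t' z'. s - \<tau> \<le> t' \<and> t' \<le> s \<and> \<bar>z' - c t'\<bar> \<le> R \<and> \<kappa> / 2 < V z' t' - W (z' + a) t'"
    if s: "T1 + \<tau> \<le> s" for s
  proof (rule ccontr)
    assume *: "\<not> ?thesis"
    have up: "V z s - W (z + a) s \<le> \<kappa> / 2 + 2 * M * exp (- \<mu> * (s - (s - \<tau>)))" for z
    proof (rule tail_decay[OF V Wa _ _ _ \<mu>, where T = s])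
      fix z t assume t: "s - \<tau> < t" "t \<le> s" and gt: "\<kappa> / 2 < V z t - W (z + a) t"
      then have "R < \<bar>z - c t\<bar>" using * by force
      then show "f t (V z t) - f t (W (z + a) t) \<le> - \<mu> * (V z t - W (z + a) t)"
        using dissipativeD(2)[OF R, of a t z] a gt \<kappa> t s by (simp add: T1_def)
    qed (use \<kappa> s \<tau> in \<open>auto simp: T1_def\<close>)
    have "V z s - W (z + a) s \<le> \<kappa>" for z using up[of z] \<tau>(2)[of \<tau>] \<kappa> by simp
    moreover have "W (z + a) s - V z s \<le> \<kappa>" for z
      using T'[of s z] s \<tau>(1) \<kappa> T1 by auto
    ultimately have "\<bar>V z s - W (z + a) s\<bar> \<le> \<kappa>" for z by (simp add: abs_le_iff)
    moreover have "T \<le> s" using s \<tau>(1) T1 by linarith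
    ultimately show False using far[of s] by (meson not_le)
  qed
  \<comment> \<open>Moving by at most \<open>r\<close> changes \<open>V\<close> and \<open>W\<close>
    by at most \<open>\<kappa> / 8\<close> each, so a gap above \<open>\<kappa> / 2\<close> stays
    above \<open>\<kappa> / 4\<close>.\<close>
  define r where "r = \<kappa> / (8 * (L + 1))"
  have r: "r > 0" "L * r \<le> \<kappa> / 8" using \<kappa> L_nonneg by (auto simp: r_def field_simps)
  have "\<kappa> / 4 > 0" "\<tau> + 1 \<ge> 1" using \<kappa> \<tau> by auto
  \<comment> \<open>Both points lie within \<open>R\<close> of the moving centre, and the centre
    moves by at most \<open>C * (\<tau> + 1)\<close>; this gives the distance to be bridged.\<close>
  obtain m where m: "m > 0"
    "\<forall>s t \<eta> y z. 0 \<le> s \<longrightarrow> s + 1 \<le> t \<longrightarrow> t \<le> s + (\<tau> + 1) \<longrightarrow> \<bar>z - y\<bar> \<le> 2 * R + C * (\<tau> + 1) \<longrightarrow>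
      \<eta> \<ge> 0 \<longrightarrow> (\<forall>z t'. s \<le> t' \<longrightarrow> t' \<le> t \<longrightarrow> W (z + a) t' - V z t' \<le> \<eta>) \<longrightarrow>
      (\<forall>z. \<bar>z - y\<bar> \<le> r \<longrightarrow> \<kappa> / 4 \<le> V z s - W (z + a) s) \<longrightarrow>
      m - \<eta> * exp (B * (\<tau> + 1)) \<le> V z t - W (z + a) t"
    using spreading[OF Wa V _ B \<open>\<kappa> / 4 > 0\<close> r(1) \<open>\<tau> + 1 \<ge> 1\<close>, of "2 * R + C * (\<tau> + 1)"] lip
    by (elim meta_impE exE conjE) (blast, rule that)
  \<comment> \<open>The loss in \<open>spreading\<close> then equals half of the gain
    \<open>m\<close>.\<close>
  define \<eta> where "\<eta> = m / 2 / exp (B * (\<tau> + 1))"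
  have \<eta>: "\<eta> > 0" "\<eta> * exp (B * (\<tau> + 1)) = m / 2" using m by (auto simp: \<eta>_def)
  obtain T2 where T2: "T2 \<ge> 0" "\<And>t z. T2 \<le> t \<Longrightarrow> W (z + a) t \<le> V z t + \<eta>"
    using below[OF \<eta>(1)] by auto
  show ?thesis
  proof (rule that[of "m / 2" "max T1 T2 + \<tau> + 1"])
    fix t z assume t: "max T1 T2 + \<tau> + 1 \<le> t" and z: "\<bar>z - c t\<bar> \<le> R"
    \<comment> \<open>The window ends at \<open>t - 1\<close>, which leaves the unit of time that
      \<open>spreading\<close> requires.\<close>
    obtain s y where s: "t - 1 - \<tau> \<le> s" "s \<le> t - 1" "\<bar>y - c s\<bar> \<le> R" "\<kappa> / 2 < V y s - W (y + a) s"
      using large[of "t - 1"] t max.cobounded1[of T1 T2] by force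
    have s1: "s \<ge> 1" "s \<ge> T2"
      using s t T1 max.cobounded1[of T1 T2] max.cobounded2[of T2 T1] by linarith+
    have "m - \<eta> * exp (B * (\<tau> + 1)) \<le> V z t - W (z + a) t"
    proof (rule m(2)[rule_format, where s = s and t = t and z = z and y = y])
      have "C * \<bar>t - s\<bar> \<le> C * (\<tau> + 1)"
      proof (rule mult_left_mono)
        show "C \<ge> 0" using speed[of 1 0] by simp
      qed (use s in auto)
      then show "\<bar>z - y\<bar> \<le> 2 * R + C * (\<tau> + 1)" using z s(3) speed[of t s] by linarith
      show "W (z + a) t' - V z t' \<le> \<eta>" if "s \<le> t'" "t' \<le> t" for z t'
        using T2(2)[of t' z] that s1 by simp
      show "\<kappa> / 4 \<le> V z s - W (z + a) s" if z: "\<bar>z - y\<bar> \<le> r" for z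
      proof -
        have "L * \<bar>z - y\<bar> \<le> \<kappa> / 8" using mult_left_mono[OF z L_nonneg] r by simp
        then show ?thesis
          using V_lipschitz[OF s1(1), of z y] W_lipschitz[OF s1(1), of "z + a" "y + a"] s(4) by simp
      qed
    qed (use s s1 \<eta> in auto)
    then show "W (z + a) t + m / 2 \<le> V z t" using \<eta> by simp
  qed (use m T2 \<tau> in auto)
qed

text \<open>\<open>a\<close> is the supremum of the shifts satisfying \<open>below\<close>, attained
  by \<open>below_closed\<close>. If \<open>V\<close> stayed away from the translate by
  \<open>a\<close> at all late times, \<open>tube_positive\<close> and \<open>below_extend\<close>
  would allow a larger shift.\<close>

lemma sliding_dichotomy:
  assumes "a0 > 0" "below a0" and not: "\<not> below a1"
  obtains a where "a > 0" "below a"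
    "\<And>\<kappa> T. \<kappa> > 0 \<Longrightarrow> \<exists>s\<ge>T. \<forall>z. \<bar>V z s - W (z + a) s\<bar> \<le> \<kappa>"
proof -
  have bdd: "bdd_above {a. below a}"
    using below_antimono not by (intro bdd_aboveI[of _ a1]) (metis linear mem_Collect_eq)
  define a where "a = Sup {a. below a}"
  have upper: "x \<le> a" if "below x" for x
    unfolding a_def using that bdd by (intro cSup_upper) auto
  have a: "a > 0" using upper[OF assms(2)] assms(1) by simp
  have "below x" if "x < a" for x
    using that less_cSup_iff[of "{a. below a}" x] bdd assms(2) below_antimono unfolding a_def
    by (metis empty_iff less_imp_le mem_Collect_eq)
  then have ba: "below a" using below_closed[OF a] by blast
  show ?thesis
  proof (rule that[OF a ba], rule ccontr)
    fix \<kappa> T :: real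
    assume \<kappa>: "\<kappa> > 0" and "\<not> (\<exists>s\<ge>T. \<forall>z. \<bar>V z s - W (z + a) s\<bar> \<le> \<kappa>)"
    then have far: "\<exists>z. \<kappa> < \<bar>V z s - W (z + a) s\<bar>" if "T \<le> s" for s
      using that by (meson not_le)
    obtain R where R: "dissipative_outside R (a + 1)"
      using tails[of "a + 1"] unfolding dissipative_outside_def by blast
    then have Ra: "dissipative_outside R a"
      unfolding dissipative_outside_def by simp
    obtain m T0 where "m > 0" "T0 \<ge> 0"
      "\<And>t z. T0 \<le> t \<Longrightarrow> \<bar>z - c t\<bar> \<le> R \<Longrightarrow> W (z + a) t + m \<le> V z t"
      using tube_positive[OF less_imp_le[OF a] ba Ra \<kappa> far] by blast
    then obtain h where "h > 0" "below (a + h)"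
      using below_extend[OF less_imp_le[OF a] ba R] by blast
    then show False using upper[of "a + h"] by simp
  qed
qed

end

section \<open>The nonlinearity\<close>

lemma C1_admissible_deriv:
  "C1_admissible f \<Longrightarrow> (f t has_real_derivative deriv (f t) u) (at u)"
  by (simp add: C1_admissible_def DERIV_deriv_iff_real_differentiable)

lemma admissible_bounded:
  fixes F :: "real \<Rightarrow> real \<Rightarrow> real"
  assumes "admissible UNIV F"
  obtains K where "\<And>t p. \<bar>p\<bar> \<le> M \<Longrightarrow> \<bar>F t p\<bar> \<le> K"
proof -
  have "bounded ((\<lambda>(t, w). F t w) ` (UNIV \<times> cball 0 M))"
    using assms unfolding admissible_def by auto
  then obtain K where "\<forall>t. \<forall>p\<in>cball 0 M. \<bar>F t p\<bar> \<le> K"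
    unfolding bounded_iff by auto
  then show ?thesis by (intro that[of K]) auto
qed

lemma C1_admissible_lipschitz:
  assumes "C1_admissible f"
  obtains B where "B \<ge> 0"
    "\<And>t p q. \<bar>p\<bar> \<le> M \<Longrightarrow> \<bar>q\<bar> \<le> M \<Longrightarrow> \<bar>f t p - f t q\<bar> \<le> B * \<bar>p - q\<bar>"
proof -
  obtain B where B: "\<And>t p. \<bar>p\<bar> \<le> M \<Longrightarrow> \<bar>deriv (f t) p\<bar> \<le> B"
    using admissible_bounded[of "\<lambda>t. deriv (f t)"] assms unfolding C1_admissible_def by blast
  have *: "\<bar>f t p - f t q\<bar> \<le> B * \<bar>p - q\<bar>" if "\<bar>p\<bar> \<le> M" "\<bar>q\<bar> \<le> M" for t p q
  proof -
    have "norm (f t p - f t q) \<le> B * norm (p - q)"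
      using B that C1_admissible_deriv[OF assms]
      by (intro field_differentiable_bound[of "cball 0 M" "f t" "deriv (f t)"])
         (auto intro: has_field_derivative_at_within)
    then show ?thesis by simp
  qed
  show ?thesis
  \<comment> \<open>For negative \<open>M\<close> the bound on the derivative is vacuous and
    \<open>B\<close> could be negative.\<close>
  proof (rule that[of "max B 0"])
    show "\<bar>f t p - f t q\<bar> \<le> max B 0 * \<bar>p - q\<bar>" if "\<bar>p\<bar> \<le> M" "\<bar>q\<bar> \<le> M" for t p q
      using *[OF that, of t] mult_right_mono[of B "max B 0" "\<bar>p - q\<bar>"] by linarith
  qed simp
qed

text \<open>The mean value theorem supplies an intermediate point, which is still within
  \<open>e\<close> of \<open>w\<close>; the product form is symmetric in \<open>p\<close> and
  \<open>q\<close>.\<close>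

lemma deriv_dissipative:
  assumes "C1_admissible f" and d: "\<And>u. \<bar>u - w\<bar> < e \<Longrightarrow> deriv (f t) u \<le> - \<mu>"
    and "\<bar>p - w\<bar> < e" "\<bar>q - w\<bar> < e"
  shows "(p - q) * (f t p - f t q) \<le> - \<mu> * (p - q)\<^sup>2"
proof -
  have *: "(p - q) * (f t p - f t q) \<le> - \<mu> * (p - q)\<^sup>2"
    if lt: "p < q" and p: "\<bar>p - w\<bar> < e" and q: "\<bar>q - w\<bar> < e" for p q
  proof -
    obtain \<xi> where \<xi>: "p < \<xi>" "\<xi> < q" "f t q - f t p = (q - p) * deriv (f t) \<xi>"
      using MVT2[OF lt, of "f t" "deriv (f t)"] C1_admissible_deriv[OF assms(1)] by blast
    have "deriv (f t) \<xi> \<le> - \<mu>" using d p q \<xi> by auto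
    then have "(p - q)\<^sup>2 * deriv (f t) \<xi> \<le> (p - q)\<^sup>2 * - \<mu>" by (intro mult_left_mono) auto
    moreover have "f t p - f t q = (p - q) * deriv (f t) \<xi>"
      using \<xi>(3) by (simp add: algebra_simps)
    then have "(p - q) * (f t p - f t q) = (p - q)\<^sup>2 * deriv (f t) \<xi>"
      by (simp add: power2_eq_square)
    ultimately show ?thesis by (simp add: mult.commute)
  qed
  show ?thesis
    using *[of p q] *[of q p] assms(3,4)
    by (cases p q rule: linorder_cases) (auto simp: power2_commute algebra_simps)
qed

section \<open>Almost periodic functions\<close>

lemma relatively_dense_shift:
  assumes "relatively_dense S"
  obtains L where "L > 0" "\<And>a. \<exists>\<tau>\<in>S. a \<le> \<tau> \<and> \<tau> \<le> a + L"
  using assms unfolding relatively_dense_def by blast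

text \<open>A 1-almost period moves any time into the compact window \<open>[0, L]\<close> at the
  cost of 1. The parameter set serves both scalar functions and waves on a bounded range of
  \<open>x\<close>.\<close>

lemma bounded_of_relatively_dense:
  fixes g :: "'a \<Rightarrow> real \<Rightarrow> real"
  assumes dense: "relatively_dense {\<tau>. \<forall>x\<in>B. \<forall>t. \<bar>g x (t + \<tau>) - g x t\<bar> < 1}"
    and local: "\<And>L. \<exists>M. \<forall>x\<in>B. \<forall>t\<in>{0..L}. \<bar>g x t\<bar> \<le> M"
  shows "\<exists>M. \<forall>x\<in>B. \<forall>t. \<bar>g x t\<bar> \<le> M"
proof -
  obtain L where L: "L > 0"
    "\<And>a. \<exists>\<tau>. (\<forall>x\<in>B. \<forall>t. \<bar>g x (t + \<tau>) - g x t\<bar> < 1) \<and> a \<le> \<tau> \<and> \<tau> \<le> a + L"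
    using relatively_dense_shift[OF dense] by auto
  obtain M where M: "\<forall>x\<in>B. \<forall>t\<in>{0..L}. \<bar>g x t\<bar> \<le> M"
    using local[of L] by blast
  have "\<bar>g x t\<bar> \<le> M + 1" if x: "x \<in> B" for x t
  proof -
    obtain \<tau> where \<tau>: "\<bar>g x (t + \<tau>) - g x t\<bar> < 1" "- t \<le> \<tau>" "\<tau> \<le> - t + L"
      using L(2)[of "- t"] x by auto
    have "\<bar>g x (t + \<tau>)\<bar> \<le> M" using M x \<tau> by simp
    then show ?thesis using \<tau>(1) by linarith
  qed
  then show ?thesis by blast
qed

lemma almost_periodic_bounded:
  assumes "almost_periodic F"
  shows "\<exists>M. \<forall>t. \<bar>F t\<bar> \<le> M"
proof -
  have "\<exists>M. \<forall>x\<in>{()}. \<forall>t. \<bar>F t\<bar> \<le> M"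
  proof (rule bounded_of_relatively_dense)
    show "relatively_dense {\<tau>. \<forall>x\<in>{()}. \<forall>t. \<bar>F (t + \<tau>) - F t\<bar> < 1}"
      using assms unfolding almost_periodic_def by simp
    fix L
    have "bounded (F ` {0..L})"
      using assms unfolding almost_periodic_def
      by (intro compact_imp_bounded compact_continuous_image) (auto elim: continuous_on_subset)
    then show "\<exists>M. \<forall>x\<in>{()}. \<forall>t\<in>{0..L}. \<bar>F t\<bar> \<le> M"
      unfolding bounded_iff by auto
  qed
  then show ?thesis by simp
qed

lemma wave_bounded:
  assumes ap: "almost_periodic_unif_bounded \<phi>" and con: "connects \<phi> u_minus u_plus"
  obtains M where "\<And>x t. \<bar>\<phi> x t\<bar> \<le> M"
proof -
  have "\<forall>\<^sub>F x in at_top. \<forall>t. dist (\<phi> x t) (u_plus t) < 1"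
    "\<forall>\<^sub>F x in at_bot. \<forall>t. dist (\<phi> x t) (u_minus t) < 1"
    using con unfolding connects_def uniform_limit_iff by auto
  then obtain R1 R2 where R: "\<And>x t. x \<ge> R1 \<Longrightarrow> dist (\<phi> x t) (u_plus t) < 1"
    "\<And>x t. x \<le> R2 \<Longrightarrow> dist (\<phi> x t) (u_minus t) < 1"
    unfolding eventually_at_top_linorder eventually_at_bot_linorder by blast
  define B where "B = {min R1 R2..max R1 R2}"
  have "\<exists>M. \<forall>x\<in>B. \<forall>t. \<bar>\<phi> x t\<bar> \<le> M"
  proof (rule bounded_of_relatively_dense)
    show "relatively_dense {\<tau>. \<forall>x\<in>B. \<forall>t. \<bar>\<phi> x (t + \<tau>) - \<phi> x t\<bar> < 1}"
      using ap unfolding almost_periodic_unif_bounded_def by (auto simp: B_def)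
    fix L :: real
    have "bounded ((\<lambda>(x, t). \<phi> x t) ` (B \<times> {0..L}))"
      using ap unfolding almost_periodic_unif_bounded_def
      by (intro compact_imp_bounded compact_continuous_image)
         (auto elim: continuous_on_subset intro: compact_Times simp: B_def)
    then show "\<exists>M. \<forall>x\<in>B. \<forall>t\<in>{0..L}. \<bar>\<phi> x t\<bar> \<le> M"
      unfolding bounded_iff by auto
  qed
  then obtain M where M: "\<And>x t. x \<in> B \<Longrightarrow> \<bar>\<phi> x t\<bar> \<le> M" by blast
  show ?thesis
  \<comment> \<open>Beyond \<open>R1\<close> or \<open>R2\<close> the wave is compared with its
    value at that endpoint, which lies in \<open>B\<close>, through the common limit; each of the
    two comparisons costs 1.\<close>
  proof (rule that[of "M + 2"])
    fix x t
    consider "x \<in> B" | "x \<ge> R1" | "x \<le> R2" by (fastforce simp: B_def)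
    then show "\<bar>\<phi> x t\<bar> \<le> M + 2"
    proof cases
      case 1
      then show ?thesis using M[of x t] by simp
    next
      case 2
      then show ?thesis using M[of R1 t] R(1)[of x t] R(1)[of R1 t] by (auto simp: B_def dist_real_def)
    next
      case 3
      then show ?thesis using M[of R2 t] R(2)[of x t] R(2)[of R2 t] by (auto simp: B_def dist_real_def)
    qed
  qed
qed

text \<open>A large almost period common to \<open>x\<close> and \<open>y\<close> carries the time
  \<open>t\<close> beyond \<open>T\<close> while changing both values by less than
  \<open>d / 2\<close>.\<close>

lemma almost_periodic_le_of_eventually_le:
  assumes ap: "almost_periodic_unif_bounded \<phi>"
    and le: "\<And>t. T \<le> t \<Longrightarrow> \<phi> x t \<le> \<phi> y t + e"
  shows "\<phi> x t \<le> \<phi> y t + e"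
proof (rule field_le_epsilon)
  fix d :: real assume "d > 0"
  then have "relatively_dense {\<tau>. \<forall>x\<in>{x, y}. \<forall>t. \<bar>\<phi> x (t + \<tau>) - \<phi> x t\<bar> < d / 2}"
    using ap unfolding almost_periodic_unif_bounded_def by (meson finite.intros finite_imp_bounded half_gt_zero)
  then obtain \<tau> where \<tau>: "\<forall>x\<in>{x, y}. \<forall>t. \<bar>\<phi> x (t + \<tau>) - \<phi> x t\<bar> < d / 2" "T - t \<le> \<tau>"
    unfolding relatively_dense_def by blast
  then have "\<bar>\<phi> x (t + \<tau>) - \<phi> x t\<bar> < d / 2" "\<bar>\<phi> y (t + \<tau>) - \<phi> y t\<bar> < d / 2" "T \<le> t + \<tau>"
    by auto
  then show "\<phi> x t \<le> \<phi> y t + e + d" using le[of "t + \<tau>"] by linarith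
qed

section \<open>The Cauchy problem\<close>

text \<open>The real supremum controls the values only of a bounded function, hence the explicit
  bound \<open>M\<close>.\<close>

lemma sup_norm_lessD:
  assumes "sup_norm g < e" "\<And>z. \<bar>g z\<bar> \<le> M"
  shows "\<bar>g z\<bar> < e"
proof -
  have "\<bar>g z\<bar> \<le> sup_norm g"
    unfolding sup_norm_def using assms(2) by (intro cSUP_upper bdd_aboveI[of _ M]) auto
  then show ?thesis using assms(1) by simp
qed

lemma sup_norm_le:
  assumes "\<And>z. \<bar>g z\<bar> \<le> e"
  shows "sup_norm g \<le> e"
  unfolding sup_norm_def using assms by (intro cSUP_least) auto

lemma C_unif_bounded: "g \<in> C_unif \<Longrightarrow> \<exists>M. \<forall>z. \<bar>g z\<bar> \<le> M"
  unfolding C_unif_def bounded_iff by auto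

lemma C_unif_translate: "g \<in> C_unif \<Longrightarrow> (\<lambda>z. g (z + a)) \<in> C_unif"
proof -
  assume g: "g \<in> C_unif"
  have "uniformly_continuous_on (range (\<lambda>z. z + a)) g"
    using g surj_plus_right[of a] by (simp add: C_unif_def)
  moreover have "uniformly_continuous_on UNIV (\<lambda>z. z + a)"
    by (intro uniformly_continuous_on_add uniformly_continuous_on_id uniformly_continuous_on_const)
  ultimately have "uniformly_continuous_on UNIV (\<lambda>z. g (z + a))"
    by (rule uniformly_continuous_on_compose[rotated])
  moreover have "bounded (range (\<lambda>z. g (z + a)))"
  proof (rule bounded_subset)
    show "bounded (range g)" using g by (simp add: C_unif_def)
  qed auto
  ultimately show ?thesis by (simp add: C_unif_def)
qed

lemma cauchy_solution_in_C_unif: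
  "cauchy_solution f I u0 u \<Longrightarrow> t \<in> I \<Longrightarrow> (\<lambda>z. u z t) \<in> C_unif"
  by (simp add: cauchy_solution_def)

text \<open>The interval \<open>{0..0}\<close> has empty interior, so the equation is vacuous there.
  This lets stability be invoked with \<open>s = 0\<close> for arbitrary data.\<close>

lemma cauchy_solution_at_0:
  assumes "u0 \<in> C_unif"
  shows "cauchy_solution f {0..0} u0 (\<lambda>z t. u0 z)"
  using assms unfolding cauchy_solution_def classical_solution_def uniform_limit_iff by auto

lemma cauchy_solution_translate:
  assumes "cauchy_solution f I u0 u"
  shows "cauchy_solution f I (\<lambda>z. u0 (z + a)) (\<lambda>z. u (z + a))"
  unfolding cauchy_solution_def
proof (intro conjI ballI allI)
  show "u (z + a) 0 = u0 (z + a)" for z using assms by (simp add: cauchy_solution_def)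
  show "(\<lambda>z. u (z + a) t) \<in> C_unif" if "t \<in> I" for t
    using assms that C_unif_translate[of "\<lambda>z. u z t"] by (simp add: cauchy_solution_def)
  show "uniform_limit UNIV (\<lambda>s z. u (z + a) s) (\<lambda>z. u (z + a) t) (at t within I)" if "t \<in> I" for t
  proof (rule uniform_limitI)
    fix e :: real assume "e > 0"
    with assms that have "\<forall>\<^sub>F s in at t within I. \<forall>z\<in>UNIV. dist (u z s) (u z t) < e"
      unfolding cauchy_solution_def uniform_limit_iff by blast
    then show "\<forall>\<^sub>F s in at t within I. \<forall>z\<in>UNIV. dist (u (z + a) s) (u (z + a) t) < e"
      by eventually_elim auto
  qed
  show "classical_solution f (interior I) (\<lambda>z. u (z + a))"
    using assms classical_solution_translate by (simp add: cauchy_solution_def)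
qed

lemma classical_solution_subset:
  assumes "classical_solution f J u" "J' \<subseteq> J"
  shows "classical_solution f J' u"
proof -
  have sub: "UNIV \<times> J' \<subseteq> UNIV \<times> J" using assms(2) by auto
  obtain ut uz uzz where
    "continuous_on (UNIV \<times> J) (\<lambda>(z, t). ut z t)"
    "continuous_on (UNIV \<times> J) (\<lambda>(z, t). uz z t)"
    "continuous_on (UNIV \<times> J) (\<lambda>(z, t). uzz z t)"
    "\<And>z t. t \<in> J \<Longrightarrow> ((\<lambda>s. u z s) has_real_derivative ut z t) (at t) \<and>
        ((\<lambda>y. u y t) has_real_derivative uz z t) (at z) \<and>
        ((\<lambda>y. uz y t) has_real_derivative uzz z t) (at z) \<and>
        ut z t = uzz z t + f t (u z t)"
    using assms(1) unfolding classical_solution_def by metis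
  then show ?thesis
    unfolding classical_solution_def using continuous_on_subset[OF _ sub] assms(2)
    by (intro exI[of _ ut] exI[of _ uz] exI[of _ uzz]) auto
qed

lemma cauchy_solution_subset:
  assumes u: "cauchy_solution f I u0 u" and sub: "I' \<subseteq> I"
  shows "cauchy_solution f I' u0 u"
  unfolding cauchy_solution_def
proof (intro conjI ballI allI)
  show "u z 0 = u0 z" for z using u by (simp add: cauchy_solution_def)
  fix t assume t: "t \<in> I'"
  then have "t \<in> I" using sub by auto
  then show "(\<lambda>z. u z t) \<in> C_unif" using u by (simp add: cauchy_solution_def)
  have "uniform_limit UNIV (\<lambda>s z. u z s) (\<lambda>z. u z t) (at t within I)"
    using u \<open>t \<in> I\<close> by (simp add: cauchy_solution_def)
  then show "uniform_limit UNIV (\<lambda>s z. u z s) (\<lambda>z. u z t) (at t within I')"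
    by (rule filterlim_mono[OF _ order_refl at_le[OF sub]])
next
  show "classical_solution f (interior I') u"
    using u classical_solution_subset[OF _ interior_mono[OF sub]] by (simp add: cauchy_solution_def)
qed

text \<open>Convergence in time is uniform in \<open>z\<close>, and each time slice is continuous;
  the triangle inequality combines the two into joint continuity.\<close>

lemma cauchy_solution_continuous:
  assumes "cauchy_solution f I u0 u"
  shows "continuous_on (UNIV \<times> I) (\<lambda>(z, t). u z t)"
  unfolding continuous_on_iff
proof (intro ballI allI impI)
  fix p :: "real \<times> real" and e :: real
  assume p: "p \<in> UNIV \<times> I" and e: "e > 0"
  obtain z t where zt: "p = (z, t)" "t \<in> I" using p by auto
  have "\<forall>\<^sub>F s in at t within I. \<forall>z\<in>UNIV. dist (u z s) (u z t) < e / 2"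
    using assms zt e unfolding cauchy_solution_def uniform_limit_iff by (meson half_gt_zero)
  then obtain d1 where d1: "d1 > 0"
    "\<And>s z. s \<in> I \<Longrightarrow> s \<noteq> t \<Longrightarrow> dist s t < d1 \<Longrightarrow> dist (u z s) (u z t) < e / 2"
    unfolding eventually_at by blast
  have "uniformly_continuous_on UNIV (\<lambda>z. u z t)"
    using assms zt by (auto simp: cauchy_solution_def C_unif_def)
  then obtain d2 where d2: "d2 > 0" "\<And>y. dist y z < d2 \<Longrightarrow> dist (u y t) (u z t) < e / 2"
    using e unfolding uniformly_continuous_on_def by (meson UNIV_I half_gt_zero)
  show "\<exists>d>0. \<forall>q\<in>UNIV \<times> I. dist q p < d \<longrightarrow> dist (case q of (z, t) \<Rightarrow> u z t) (case p of (z, t) \<Rightarrow> u z t) < e"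
  proof (intro exI[of _ "min d1 d2"] conjI ballI impI)
    fix q assume q: "q \<in> UNIV \<times> I" "dist q p < min d1 d2"
    obtain y s where ys: "q = (y, s)" "s \<in> I" using q by auto
    have "dist y z < d2" "dist s t < d1"
      using q(2) dist_fst_le[of q p] dist_snd_le[of q p] by (auto simp: ys zt)
    then have "dist (u y s) (u y t) < e / 2" "dist (u y t) (u z t) < e / 2"
      using d1(2)[of s y] d2 ys e by (cases "s = t"; force)+
    then show "dist (case q of (z, t) \<Rightarrow> u z t) (case p of (z, t) \<Rightarrow> u z t) < e"
      using dist_triangle_half_r[of "u y t" "u y s" e "u z t"] by (simp add: ys zt dist_commute)
  qed (use d1 d2 in auto)
qed

text \<open>Continuity in the sup norm gives a bound near each time, and finitely many such
  neighbourhoods cover \<open>[0, s]\<close>. It serves for times before \<open>s\<close>, on which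
  the stability estimate is silent.\<close>

lemma cauchy_solution_bounded_interval:
  assumes u: "cauchy_solution f I u0 u" and "{0..s} \<subseteq> I"
  shows "\<exists>M. \<forall>t\<in>{0..s}. \<forall>z. \<bar>u z t\<bar> \<le> M"
proof -
  have near: "\<exists>d>0. \<exists>M. \<forall>r\<in>{0..s}. dist r t < d \<longrightarrow> (\<forall>z. \<bar>u z r\<bar> \<le> M)" if t: "t \<in> {0..s}" for t
  proof -
    have tI: "t \<in> I" using t assms(2) by auto
    have "\<forall>\<^sub>F r in at t within I. \<forall>z\<in>UNIV. dist (u z r) (u z t) < 1"
      using u tI unfolding cauchy_solution_def uniform_limit_iff by (meson zero_less_one)
    then obtain d where d: "d > 0"
      "\<And>r z. r \<in> I \<Longrightarrow> r \<noteq> t \<Longrightarrow> dist r t < d \<Longrightarrow> dist (u z r) (u z t) < 1"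
      unfolding eventually_at by blast
    obtain M where M: "\<And>z. \<bar>u z t\<bar> \<le> M"
      using u tI C_unif_bounded[of "\<lambda>z. u z t"] unfolding cauchy_solution_def by blast
    have "\<bar>u z r\<bar> \<le> M + 1" if "r \<in> {0..s}" "dist r t < d" for r z
      using d(2)[of r z] M[of z] that assms(2) by (cases "r = t") (auto simp: dist_real_def)
    then show ?thesis using d(1) by blast
  qed
  then obtain d M where dM: "\<And>t. t \<in> {0..s} \<Longrightarrow> d t > 0"
    "\<And>t r z. t \<in> {0..s} \<Longrightarrow> r \<in> {0..s} \<Longrightarrow> dist r t < d t \<Longrightarrow> \<bar>u z r\<bar> \<le> M t"
    by metis
  obtain F where F: "F \<subseteq> {0..s}" "finite F" "{0..s} \<subseteq> (\<Union>t\<in>F. ball t (d t))"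
    by (rule compactE_image[of "{0..s}" "{0..s}" "\<lambda>t. ball t (d t)"]) (use dM(1) in force)+
  show ?thesis
  proof (intro exI ballI allI)
    fix r z assume r: "r \<in> {0..s}"
    then obtain t where t: "t \<in> F" "dist t r < d t" using F(3) by auto
    then have "\<bar>u z r\<bar> \<le> M t" using dM(2)[of t r z] r F(1) by (auto simp: dist_commute)
    also have "\<dots> \<le> Max (M ` F)" using t F(2) by auto
    finally show "\<bar>u z r\<bar> \<le> Max (M ` F)" .
  qed
qed

lemma cauchy_solution_bounded_solution:
  assumes "cauchy_solution f {0..} u0 u" "\<And>z t. 0 \<le> t \<Longrightarrow> \<bar>u z t\<bar> \<le> M"
  shows "bounded_solution f M u"
  using assms cauchy_solution_continuous[OF assms(1)]
  unfolding bounded_solution_def by (simp add: cauchy_solution_def)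

lemma bounded_solution_mono:
  assumes "bounded_solution f M u" "M \<le> M'"
  shows "bounded_solution f M' u"
proof -
  have "\<bar>u z t\<bar> \<le> M'" if "0 \<le> t" for z t
    using bounded_solutionD[OF assms(1) that, of z] assms(2) by linarith
  then show ?thesis using assms(1) by (simp add: bounded_solution_def)
qed

lemma bounded_cauchy_solution_unique:
  assumes "C1_admissible f" "bounded_solution f M u" "bounded_solution f M' v"
    and "\<And>z. u z 0 = v z 0" and "0 \<le> t"
  shows "u z t = v z t"
proof -
  define N where "N = max M M'"
  have u: "bounded_solution f N u" and v: "bounded_solution f N v"
    using bounded_solution_mono assms(2,3) by (auto simp: N_def)
  obtain B where "B \<ge> 0"
    and B: "\<And>t p q. \<bar>p\<bar> \<le> N \<Longrightarrow> \<bar>q\<bar> \<le> N \<Longrightarrow> \<bar>f t p - f t q\<bar> \<le> B * \<bar>p - q\<bar>"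
    by (rule C1_admissible_lipschitz[OF assms(1), of N]) (rule that)
  show ?thesis
  proof (rule order.antisym)
    show "u z t \<le> v z t" by (rule comparison[OF u v order_refl B _ assms(5)]) (simp_all add: assms(4))
    show "v z t \<le> u z t" by (rule comparison[OF v u order_refl B _ assms(5)]) (simp_all add: assms(4))
  qed
qed

section \<open>Stable waves are monotone\<close>

lemma C1_differentiable_on_imp_DERIV:
  assumes "c C1_differentiable_on UNIV"
  shows "(c has_real_derivative deriv c t) (at t)"
proof -
  obtain D where "(c has_vector_derivative D) (at t)"
    using assms unfolding C1_differentiable_on_def by blast
  then have "(c has_real_derivative D) (at t)"
    by (simp add: has_real_derivative_iff_has_vector_derivative)
  then show ?thesis using DERIV_imp_deriv by metis
qed

text \<open>The step from \<open>x\<close> to \<open>y\<close> is divided into \<open>n\<close>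
  equal steps of length at most \<open>a\<close>.\<close>

lemma mono_of_short_shifts:
  fixes g :: "real \<Rightarrow> real"
  assumes "a > 0" and shift: "\<And>x h. 0 \<le> h \<Longrightarrow> h \<le> a \<Longrightarrow> g x \<le> g (x + h)"
  shows "mono g"
proof (rule monoI)
  fix x y :: real assume "x \<le> y"
  obtain n :: nat where n: "(y - x) / a < real n" using reals_Archimedean2 by blast
  then have n0: "real n > 0" using \<open>x \<le> y\<close> \<open>a > 0\<close> by (smt (verit) divide_nonneg_pos)
  define h where "h = (y - x) / real n"
  have h: "0 \<le> h" "h \<le> a" using n n0 \<open>x \<le> y\<close> \<open>a > 0\<close> by (auto simp: h_def field_simps)
  have "g x \<le> g (x + real k * h)" for k
  proof (induction k)
    case (Suc k)
    then show ?case using shift[OF h, of "x + real k * h"] by (simp add: algebra_simps)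
  qed simp
  from this[of n] show "g x \<le> g y" using n0 by (simp add: h_def)
qed

section \<open>Stability and sliding for a given wave\<close>

locale stable_wave =
  fixes f :: "real \<Rightarrow> real \<Rightarrow> real" and \<phi> :: "real \<Rightarrow> real \<Rightarrow> real"
    and c u_minus u_plus :: "real \<Rightarrow> real" and e0 \<mu> :: real
  assumes adm: "C1_admissible f"
    and e0: "e0 > 0" and \<mu>: "\<mu> > 0"
    and diss: "\<And>t u. \<bar>u - u_plus t\<bar> < e0 \<or> \<bar>u - u_minus t\<bar> < e0 \<Longrightarrow> deriv (f t) u \<le> - \<mu>"
    and wave: "ap_traveling_wave f \<phi> c" and con: "connects \<phi> u_minus u_plus"
    and stable: "uniformly_stable f \<phi> c"
begin

definition "W z t = \<phi> (z - c t) t"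

lemma ap: "almost_periodic_unif_bounded \<phi>"
  using wave by (simp add: ap_traveling_wave_def)

lemma speed_lipschitz:
  obtains C where "\<And>s t. \<bar>c t - c s\<bar> \<le> C * \<bar>t - s\<bar>"
proof -
  obtain C where C: "\<And>t. \<bar>deriv c t\<bar> \<le> C"
    using almost_periodic_bounded[of "deriv c"] wave unfolding ap_traveling_wave_def by blast
  have "norm (c t - c s) \<le> C * norm (t - s)" for s t
    using C C1_differentiable_on_imp_DERIV[of c] wave unfolding ap_traveling_wave_def
    by (intro field_differentiable_bound[of UNIV c "deriv c"]) auto
  then show ?thesis by (intro that[of C]) simp
qed

lemma W_bounded_solution:
  assumes "\<And>x t. \<bar>\<phi> x t\<bar> \<le> M"
  shows "bounded_solution f M W"
  unfolding bounded_solution_def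
proof (intro conjI allI impI)
  show "classical_solution f {0<..} W"
    using wave by (simp add: ap_traveling_wave_def W_def[abs_def])
  have "continuous_on UNIV c"
    using C1_differentiable_on_imp_DERIV[of c] wave unfolding ap_traveling_wave_def
    by (intro DERIV_continuous_on) (auto intro: has_field_derivative_at_within)
  then have "continuous_on (UNIV \<times> {0..}) (c \<circ> (\<lambda>p::real \<times> real. snd p))"
    by (intro continuous_on_compose) (auto intro: continuous_intros elim: continuous_on_subset)
  then have cc: "continuous_on (UNIV \<times> {0..}) (\<lambda>p::real \<times> real. c (snd p))" by (simp add: o_def)
  have "continuous_on UNIV (\<lambda>(x, t). \<phi> x t)"
    using ap by (simp add: almost_periodic_unif_bounded_def)
  then have "continuous_on (UNIV \<times> {0..}) ((\<lambda>(x, t). \<phi> x t) \<circ> (\<lambda>p. (fst p - c (snd p), snd p)))"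
    by (intro continuous_on_compose continuous_on_Pair continuous_on_diff continuous_on_fst
        continuous_on_snd continuous_on_id cc) (auto elim: continuous_on_subset)
  then show "continuous_on (UNIV \<times> {0..}) (\<lambda>(z, t). W z t)"
    by (simp add: W_def o_def case_prod_beta)
qed (use assms in \<open>simp add: W_def\<close>)

text \<open>Parabolic smoothing gives the Lipschitz bound for times at least 1; almost periodicity
  extends it to all times, including 0.\<close>

lemma phi_lipschitz:
  obtains L where "L \<ge> 0" "\<And>x y t. \<bar>\<phi> x t - \<phi> y t\<bar> \<le> L * \<bar>x - y\<bar>"
proof -
  obtain M where M: "\<And>x t. \<bar>\<phi> x t\<bar> \<le> M" by (rule wave_bounded[OF ap con]) (rule that)
  obtain K where K: "\<And>t p. \<bar>p\<bar> \<le> M \<Longrightarrow> \<bar>f t p\<bar> \<le> K"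
    by (rule admissible_bounded[of f M]) (use adm in \<open>auto simp: C1_admissible_def\<close>)
  define L where "L = 2 * (2 * M + K)"
  have "M \<ge> 0" using M[of 0 0] by simp
  moreover from this have "K \<ge> 0" using K[of 0 0] by simp
  ultimately have L: "L \<ge> 0" by (simp add: L_def)
  have *: "\<phi> x t \<le> \<phi> y t + L * \<bar>x - y\<bar>" for x y t
  proof (rule almost_periodic_le_of_eventually_le[OF ap])
    fix t :: real assume "1 \<le> t"
    then show "\<phi> x t \<le> \<phi> y t + L * \<bar>x - y\<bar>"
      using solution_lipschitz[OF W_bounded_solution[OF M] K, of t "x + c t" "y + c t"]
      by (simp add: W_def L_def)
  qed
  have "\<bar>\<phi> x t - \<phi> y t\<bar> \<le> L * \<bar>x - y\<bar>" for x y t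
    using *[of x t y] *[of y t x, unfolded abs_minus_commute[of y x]] by linarith
  then show ?thesis using L that by blast
qed

text \<open>Lifting the wave by a constant \<open>\<delta>\<close> leaves room for its small
  translates below the perturbed solution at time 0. The lifted profile belongs to
  \<open>C_unif\<close> by \<open>phi_lipschitz\<close>.\<close>

lemma stability_from_0:
  assumes "\<epsilon> > 0"
  obtains \<delta> u0 V where "\<delta> > 0" "cauchy_solution f {0..} u0 V"
    "\<And>z. V z 0 = W z 0 + \<delta>" "\<And>z t. 0 \<le> t \<Longrightarrow> \<bar>V z t - W z t\<bar> < \<epsilon>"
proof -
  obtain M where M: "\<And>x t. \<bar>\<phi> x t\<bar> \<le> M" by (rule wave_bounded[OF ap con]) (rule that)
  obtain L where L: "L \<ge> 0" "\<And>x y t. \<bar>\<phi> x t - \<phi> y t\<bar> \<le> L * \<bar>x - y\<bar>" using phi_lipschitz by blast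
  obtain \<delta> where \<delta>: "\<delta> > 0"
    "\<forall>u0\<in>C_unif. \<forall>s\<ge>0. \<forall>u. cauchy_solution f {0..s} u0 u \<and>
        sup_norm (\<lambda>z. u z s - \<phi> (z - c s) s) \<le> \<delta> \<longrightarrow>
      (\<exists>v. cauchy_solution f {0..} u0 v \<and> (\<forall>t\<ge>s. sup_norm (\<lambda>z. v z t - \<phi> (z - c t) t) < \<epsilon>))"
    using stable[unfolded uniformly_stable_def, THEN spec, THEN mp, OF assms]
    by (elim exE conjE) (rule that)
  define u0 where "u0 z = W z 0 + \<delta>" for z
  have "u0 \<in> C_unif"
    unfolding C_unif_def
  proof (intro CollectI conjI)
    have "\<bar>u0 z\<bar> \<le> M + \<delta>" for z using M[of "z - c 0" 0] \<delta>(1) by (simp add: u0_def W_def)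
    then show "bounded (range u0)" unfolding bounded_iff by auto
    show "uniformly_continuous_on UNIV u0"
      unfolding uniformly_continuous_on_def
    proof (intro allI impI)
      fix e :: real assume e: "e > 0"
      show "\<exists>d>0. \<forall>x\<in>UNIV. \<forall>x'\<in>UNIV. dist x' x < d \<longrightarrow> dist (u0 x') (u0 x) < e"
      proof (intro exI[of _ "e / (L + 1)"] conjI ballI impI)
        fix x x' :: real assume d: "dist x' x < e / (L + 1)"
        have "dist (u0 x') (u0 x) \<le> L * \<bar>x' - x\<bar>"
          using L(2)[of "x' - c 0" 0 "x - c 0"] by (simp add: u0_def W_def dist_real_def)
        also have "\<dots> \<le> L * (e / (L + 1))"
          using d L(1) by (intro mult_left_mono) (auto simp: dist_real_def)
        also have "\<dots> < e" using e L(1) by (simp add: field_simps)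
        finally show "dist (u0 x') (u0 x) < e" .
      qed (use e L in auto)
    qed
  qed
  moreover have "sup_norm (\<lambda>z. u0 z - \<phi> (z - c 0) 0) \<le> \<delta>"
    using \<delta>(1) by (intro sup_norm_le) (simp add: u0_def W_def)
  ultimately obtain V where V: "cauchy_solution f {0..} u0 V"
    "\<And>t. 0 \<le> t \<Longrightarrow> sup_norm (\<lambda>z. V z t - \<phi> (z - c t) t) < \<epsilon>"
    using \<delta>(2)[rule_format, of u0 0 "\<lambda>z t. u0 z"] cauchy_solution_at_0 by auto
  show ?thesis
  proof (rule that[OF \<delta>(1) V(1)])
    show "V z 0 = W z 0 + \<delta>" for z using V(1) by (simp add: cauchy_solution_def u0_def)
    fix z t :: real assume t: "0 \<le> t"
    obtain N where N: "\<And>z. \<bar>V z t\<bar> \<le> N"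
      using C_unif_bounded[OF cauchy_solution_in_C_unif[OF V(1), of t]] t by auto
    have "\<bar>V z t - \<phi> (z - c t) t\<bar> \<le> N + M" for z
      using N[of z] M[of "z - c t" t] by linarith
    from sup_norm_lessD[OF V(2)[OF t] this, of z]
    show "\<bar>V z t - W z t\<bar> < \<epsilon>" by (simp add: W_def)
  qed
qed

text \<open>The equation does not depend on \<open>z\<close>, so closeness of \<open>V\<close> to
  the translate by \<open>a\<close> is closeness of \<open>V\<close> translated by
  \<open>- a\<close> to \<open>W\<close>, to which stability applies. Stability yields merely some
  solution \<open>v\<close> with the same data; uniqueness identifies it with the translate of
  \<open>V\<close>.\<close>

lemma eventually_close:
  assumes V: "cauchy_solution f {0..} u0 V" "\<And>z t. 0 \<le> t \<Longrightarrow> \<bar>V z t\<bar> \<le> M"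
    and close: "\<And>\<kappa>. \<kappa> > 0 \<Longrightarrow> \<exists>s\<ge>0. \<forall>z. \<bar>V z s - W (z + a) s\<bar> \<le> \<kappa>"
    and "e > 0"
  obtains s where "s \<ge> 0" "\<And>z t. s \<le> t \<Longrightarrow> \<bar>V z t - W (z + a) t\<bar> < e"
proof -
  obtain M1 where M1: "\<And>x t. \<bar>\<phi> x t\<bar> \<le> M1" by (rule wave_bounded[OF ap con]) (rule that)
  obtain \<delta> where \<delta>: "\<delta> > 0"
    "\<forall>u0\<in>C_unif. \<forall>s\<ge>0. \<forall>u. cauchy_solution f {0..s} u0 u \<and>
        sup_norm (\<lambda>z. u z s - \<phi> (z - c s) s) \<le> \<delta> \<longrightarrow>
      (\<exists>v. cauchy_solution f {0..} u0 v \<and> (\<forall>t\<ge>s. sup_norm (\<lambda>z. v z t - \<phi> (z - c t) t) < e))"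
    using stable[unfolded uniformly_stable_def, THEN spec, THEN mp, OF \<open>e > 0\<close>]
    by (elim exE conjE) (rule that)
  obtain s where s: "s \<ge> 0" "\<And>z. \<bar>V z s - W (z + a) s\<bar> \<le> \<delta>" using close[OF \<delta>(1)] by blast
  define V' where "V' z = V (z + - a)" for z
  define u0' where "u0' z = u0 (z + - a)" for z
  have V': "cauchy_solution f {0..} u0' V'"
    using cauchy_solution_translate[OF V(1), of "- a"] by (simp add: V'_def[abs_def] u0'_def[abs_def])
  have V'0: "\<And>z. V' z 0 = u0' z" using V' by (simp add: cauchy_solution_def)
  have "u0' = (\<lambda>z. V' z 0)" by (simp add: V'0)
  then have "u0' \<in> C_unif" using cauchy_solution_in_C_unif[OF V', of 0] by simp
  moreover have "cauchy_solution f {0..s} u0' V'"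
    by (rule cauchy_solution_subset[OF V']) auto
  moreover have "sup_norm (\<lambda>z. V' z s - \<phi> (z - c s) s) \<le> \<delta>"
    using s(2)[of "z + - a" for z] by (intro sup_norm_le) (simp add: V'_def W_def)
  ultimately obtain v where v: "cauchy_solution f {0..} u0' v"
    "\<And>t. s \<le> t \<Longrightarrow> sup_norm (\<lambda>z. v z t - \<phi> (z - c t) t) < e"
    using \<delta>(2)[rule_format, of u0' s V'] s(1) by blast
  have vW: "\<bar>v z t - W z t\<bar> < e" if t: "s \<le> t" for z t
  proof -
    obtain N where N: "\<And>z. \<bar>v z t\<bar> \<le> N"
      using C_unif_bounded[OF cauchy_solution_in_C_unif[OF v(1), of t]] t s(1) by auto
    have "\<bar>v z t - \<phi> (z - c t) t\<bar> \<le> N + M1" for z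
      using N[of z] M1[of "z - c t" t] by linarith
    from sup_norm_lessD[OF v(2)[OF t] this, of z] show ?thesis by (simp add: W_def)
  qed
  \<comment> \<open>Uniqueness is available for bounded solutions: \<open>v\<close> is bounded by
    compactness up to \<open>s\<close>, and by closeness to the wave afterwards.\<close>
  obtain M2 where M2: "\<And>t z. 0 \<le> t \<Longrightarrow> t \<le> s \<Longrightarrow> \<bar>v z t\<bar> \<le> M2"
    using cauchy_solution_bounded_interval[OF v(1), of s] by force
  have "\<bar>v z t\<bar> \<le> max M2 (M1 + e)" if "0 \<le> t" for z t
  proof (cases "t \<le> s")
    case True
    then show ?thesis using M2[of t z] that by simp
  next
    case False
    then show ?thesis using vW[of t z] M1[of "z - c t" t] by (simp add: W_def)
  qed
  then have bv: "bounded_solution f (max M2 (M1 + e)) v"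
    by (rule cauchy_solution_bounded_solution[OF v(1)])
  have bV': "bounded_solution f M V'"
    by (rule cauchy_solution_bounded_solution[OF V']) (simp add: V'_def V(2))
  have eq: "v z t = V' z t" if "0 \<le> t" for z t
    using bounded_cauchy_solution_unique[OF adm bv bV' _ that] v(1) V'0
    by (simp add: cauchy_solution_def)
  show ?thesis
  proof (rule that[OF s(1)])
    fix z t assume "s \<le> t"
    then show "\<bar>V z t - W (z + a) t\<bar> < e"
      using vW[of t "z + a"] eq[of t "z + a"] s(1) by (simp add: V'_def)
  qed
qed

lemma wave_near_limits:
  obtains R where "R \<ge> 0"
    "\<And>x t. R \<le> x \<Longrightarrow> \<bar>\<phi> x t - u_plus t\<bar> < e0 / 2" "\<And>x t. x \<le> - R \<Longrightarrow> \<bar>\<phi> x t - u_minus t\<bar> < e0 / 2"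
proof -
  have "\<forall>\<^sub>F x in at_top. \<forall>t\<in>UNIV. dist (\<phi> x t) (u_plus t) < e0 / 2"
    "\<forall>\<^sub>F x in at_bot. \<forall>t\<in>UNIV. dist (\<phi> x t) (u_minus t) < e0 / 2"
    by (rule uniform_limitD; use con e0 in \<open>simp add: connects_def\<close>)+
  then obtain R1 R2 where R: "\<forall>x\<ge>R1. \<forall>t\<in>UNIV. dist (\<phi> x t) (u_plus t) < e0 / 2"
    "\<forall>x\<le>R2. \<forall>t\<in>UNIV. dist (\<phi> x t) (u_minus t) < e0 / 2"
    unfolding eventually_at_top_linorder eventually_at_bot_linorder by blast
  show ?thesis
    by (rule that[of "max 0 (max R1 (- R2))"]) (use R in \<open>auto simp: dist_real_def\<close>)
qed

text \<open>The first alternative arises when sliding stops at a finite shift, the second when it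
  never stops. The bound \<open>\<epsilon> \<le> e0 / 2\<close> keeps \<open>V\<close> within
  \<open>e0\<close> of the limit states wherever \<open>W\<close> is within \<open>e0 / 2\<close> of
  them.\<close>

lemma monotone_or_almost_antitone:
  assumes \<epsilon>: "0 < \<epsilon>" "\<epsilon> \<le> e0 / 2"
  shows "(\<forall>t. mono (\<lambda>x. \<phi> x t)) \<or> (\<forall>b\<ge>0. \<forall>x t. \<phi> (x + b) t \<le> \<phi> x t + \<epsilon>)"
proof -
  obtain M1 where M1: "\<And>x t. \<bar>\<phi> x t\<bar> \<le> M1" by (rule wave_bounded[OF ap con]) (rule that)
  obtain L where L: "L \<ge> 0" "\<And>x y t. \<bar>\<phi> x t - \<phi> y t\<bar> \<le> L * \<bar>x - y\<bar>" using phi_lipschitz by blast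
  obtain \<delta> u0 V where \<delta>: "\<delta> > 0" and V: "cauchy_solution f {0..} u0 V"
    and V0: "\<And>z. V z 0 = W z 0 + \<delta>" and VW: "\<And>z t. 0 \<le> t \<Longrightarrow> \<bar>V z t - W z t\<bar> < \<epsilon>"
    by (rule stability_from_0[OF \<epsilon>(1)]) (rule that)
  define M where "M = M1 + \<epsilon>"
  have VM: "\<bar>V z t\<bar> \<le> M" if "0 \<le> t" for z t
    using VW[OF that, of z] M1[of "z - c t" t] by (simp add: M_def W_def)
  have bV: "bounded_solution f M V" by (rule cauchy_solution_bounded_solution[OF V VM])
  have bW: "bounded_solution f M W"
  proof (rule W_bounded_solution)
    show "\<bar>\<phi> x t\<bar> \<le> M" for x t using M1[of x t] \<epsilon> by (simp add: M_def)
  qed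
  obtain K where K: "\<And>t p. \<bar>p\<bar> \<le> M \<Longrightarrow> \<bar>f t p\<bar> \<le> K"
    by (rule admissible_bounded[of f M]) (use adm in \<open>auto simp: C1_admissible_def\<close>)
  obtain B where B: "B \<ge> 0"
    "\<And>t p q. \<bar>p\<bar> \<le> M \<Longrightarrow> \<bar>q\<bar> \<le> M \<Longrightarrow> \<bar>f t p - f t q\<bar> \<le> B * \<bar>p - q\<bar>"
    by (rule C1_admissible_lipschitz[OF adm, of M]) (rule that)
  obtain C where C: "\<And>s t. \<bar>c t - c s\<bar> \<le> C * \<bar>t - s\<bar>" by (rule speed_lipschitz) (rule that)
  obtain R where R: "R \<ge> 0"
    "\<And>x t. R \<le> x \<Longrightarrow> \<bar>\<phi> x t - u_plus t\<bar> < e0 / 2" "\<And>x t. x \<le> - R \<Longrightarrow> \<bar>\<phi> x t - u_minus t\<bar> < e0 / 2"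
    by (rule wave_near_limits) (rule that)
  interpret sl: sliding f W V c M K B \<mu> C
  proof
    fix a :: real
    show "\<exists>R. \<forall>b z t. 0 \<le> b \<longrightarrow> b \<le> a \<longrightarrow> 0 \<le> t \<longrightarrow> R \<le> \<bar>z - c t\<bar> \<longrightarrow>
      (W (z + b) t - V z t) * (f t (W (z + b) t) - f t (V z t)) \<le> - \<mu> * (W (z + b) t - V z t)\<^sup>2"
    \<comment> \<open>The margin \<open>\<bar>a\<bar>\<close> keeps \<open>z\<close> and
      \<open>z + b\<close> in the same tail, so both values are near the same limit state.\<close>
    proof (intro exI[of _ "R + \<bar>a\<bar>"] allI impI)
      fix b z t assume b: "0 \<le> b" "b \<le> a" and t: "0 \<le> t" and z: "R + \<bar>a\<bar> \<le> \<bar>z - c t\<bar>"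
      obtain w where w: "\<bar>W (z + b) t - w\<bar> < e0 / 2" "\<bar>W z t - w\<bar> < e0 / 2"
        "\<And>u. \<bar>u - w\<bar> < e0 \<Longrightarrow> deriv (f t) u \<le> - \<mu>"
      proof (cases "z - c t \<ge> 0")
        case True
        then have "R \<le> z - c t" "R \<le> z + b - c t" using z b by auto
        then show ?thesis using R(2) diss by (intro that[of "u_plus t"]) (auto simp: W_def)
      next
        case False
        then have "z - c t \<le> - R" "z + b - c t \<le> - R" using z b by auto
        then show ?thesis using R(3) diss by (intro that[of "u_minus t"]) (auto simp: W_def)
      qed
      show "(W (z + b) t - V z t) * (f t (W (z + b) t) - f t (V z t)) \<le> - \<mu> * (W (z + b) t - V z t)\<^sup>2"
      proof (rule deriv_dissipative[OF adm w(3)])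
        show "\<bar>W (z + b) t - w\<bar> < e0" using w(1) e0 by simp
        show "\<bar>V z t - w\<bar> < e0" using w(2) VW[OF t, of z] \<epsilon> by linarith
      qed
    qed
  qed (use bW bV K B \<mu> C in auto)
  \<comment> \<open>A translate by at most \<open>b0\<close> raises the initial profile by at most
    \<open>L * b0 \<le> \<delta>\<close>, so it starts below \<open>V\<close>.\<close>
  define b0 where "b0 = \<delta> / (L + 1)"
  have b0: "b0 > 0" "L * b0 \<le> \<delta>" using \<delta> L(1) by (auto simp: b0_def field_simps)
  have W_le_V: "W (z + b) t \<le> V z t" if b: "0 \<le> b" "b \<le> b0" and t: "0 \<le> t" for b z t
  proof (rule comparison[OF bounded_solution_translate[OF bW] bV order_refl B(2) _ t])
    fix z
    have "W (z + b) 0 - W z 0 \<le> L * \<bar>b\<bar>"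
      using L(2)[of "z + b - c 0" 0 "z - c 0"] by (simp add: W_def)
    also have "\<dots> \<le> L * b0" using b L(1) by (intro mult_left_mono) auto
    finally show "W (z + b) 0 \<le> V z 0" using b0(2) V0[of z] by simp
  qed
  have below0: "sl.below b0"
    unfolding sl.below_def
  proof (intro allI impI exI[of _ 0] conjI)
    fix \<eta> b t z :: real assume "\<eta> > 0" "0 \<le> b" "b \<le> b0" "0 \<le> t"
    then show "W (z + b) t \<le> V z t + \<eta>" using W_le_V[of b t z] by simp
  qed simp
  show ?thesis
  proof (cases "\<forall>a. sl.below a")
    case True
    have "\<phi> (x + b) t \<le> \<phi> x t + \<epsilon>" if "b \<ge> 0" for b x t
    proof (rule field_le_epsilon)
      fix \<eta> :: real assume "\<eta> > 0"
      with True obtain T where T: "T \<ge> 0" "\<And>d t z. 0 \<le> d \<Longrightarrow> d \<le> b \<Longrightarrow> T \<le> t \<Longrightarrow> W (z + d) t \<le> V z t + \<eta>"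
        unfolding sl.below_def by metis
      have "\<phi> (x + b) t \<le> \<phi> x t + (\<epsilon> + \<eta>)"
      proof (rule almost_periodic_le_of_eventually_le[OF ap])
        fix t assume t: "T \<le> t"
        have "W (x + c t + b) t \<le> V (x + c t) t + \<eta>" using T(2)[of b t "x + c t"] that t by simp
        moreover have "V (x + c t) t \<le> W (x + c t) t + \<epsilon>" using VW[of t "x + c t"] t T(1) by simp
        ultimately show "\<phi> (x + b) t \<le> \<phi> x t + (\<epsilon> + \<eta>)" by (simp add: W_def)
      qed
      then show "\<phi> (x + b) t \<le> \<phi> x t + \<epsilon> + \<eta>" by simp
    qed
    then show ?thesis by blast
  next
    case False
    then obtain a1 where "\<not> sl.below a1" by blast
    then obtain a where a: "a > 0" "sl.below a"
      "\<And>\<kappa> T. \<kappa> > 0 \<Longrightarrow> \<exists>s\<ge>T. \<forall>z. \<bar>V z s - W (z + a) s\<bar> \<le> \<kappa>"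
      by (rule sl.sliding_dichotomy[OF b0(1) below0]) (rule that)
    \<comment> \<open>\<open>V\<close> converges uniformly to the translate by \<open>a\<close> and
      is asymptotically above every translate by \<open>b\<close> in \<open>[0, a]\<close>, so these
      translates are ordered, first at late times and then at all times.\<close>
    have le: "\<phi> (x + b) t \<le> \<phi> (x + a) t" if b: "0 \<le> b" "b \<le> a" for b x t
    proof (rule field_le_epsilon)
      fix e :: real assume "e > 0"
      then have e2: "e / 2 > 0" by simp
      obtain s where s: "s \<ge> 0" "\<And>z t. s \<le> t \<Longrightarrow> \<bar>V z t - W (z + a) t\<bar> < e / 2"
        by (rule eventually_close[OF V VM a(3) e2]) (assumption, assumption, rule that)
      obtain T where T: "\<And>d t z. 0 \<le> d \<Longrightarrow> d \<le> a \<Longrightarrow> T \<le> t \<Longrightarrow> W (z + d) t \<le> V z t + e / 2"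
        using a(2) e2 unfolding sl.below_def by metis
      show "\<phi> (x + b) t \<le> \<phi> (x + a) t + e"
      proof (rule almost_periodic_le_of_eventually_le[OF ap])
        fix t assume t: "max s T \<le> t"
        have "W (x + c t + b) t \<le> V (x + c t) t + e / 2" using T[of b t "x + c t"] b t by simp
        moreover have "\<bar>V (x + c t) t - W (x + c t + a) t\<bar> < e / 2" using s(2)[of t "x + c t"] t by simp
        ultimately have "W (x + c t + b) t \<le> W (x + c t + a) t + e" by linarith
        then show "\<phi> (x + b) t \<le> \<phi> (x + a) t + e" by (simp add: W_def algebra_simps)
      qed
    qed
    have "mono (\<lambda>x. \<phi> x t)" for t
    proof (rule mono_of_short_shifts[OF a(1)])
      fix x h assume "0 \<le> h" "h \<le> a"
      \<comment> \<open>The shifts \<open>a - h\<close> and \<open>a\<close> are compared from the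
        base point \<open>x - (a - h)\<close>.\<close>
      then show "\<phi> x t \<le> \<phi> (x + h) t" using le[of "a - h" "x - (a - h)" t] by (simp add: algebra_simps)
    qed
    then show ?thesis by blast
  qed
qed

text \<open>The first alternative of the preceding lemma does not involve \<open>\<epsilon>\<close>.
  If it fails, the second holds for every small \<open>\<epsilon>\<close>, and letting
  \<open>\<epsilon>\<close> tend to 0 gives exact antitonicity.\<close>

lemma stable_wave_monotone: "spatially_monotone \<phi>"
proof (cases "\<forall>t. mono (\<lambda>x. \<phi> x t)")
  case False
  have "\<phi> y t \<le> \<phi> x t" if "x \<le> y" for x y t
  proof (rule field_le_epsilon)
    fix e :: real assume e: "e > 0"
    define \<epsilon> where "\<epsilon> = min e (e0 / 2)"
    have "0 < \<epsilon>" "\<epsilon> \<le> e0 / 2" "\<epsilon> \<le> e" using e e0 by (auto simp: \<epsilon>_def)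
    then have "\<phi> (x + (y - x)) t \<le> \<phi> x t + \<epsilon>"
      using monotone_or_almost_antitone[of \<epsilon>] False that by (metis diff_ge_0_iff_ge)
    then show "\<phi> y t \<le> \<phi> x t + e" using \<open>\<epsilon> \<le> e\<close> by simp
  qed
  then show ?thesis unfolding spatially_monotone_def by (auto intro: antimonoI)
qed (simp add: spatially_monotone_def)

end

section \<open>Solitary waves\<close>

lemma mono_between_limits:
  fixes g :: "real \<Rightarrow> real"
  assumes "mono g" "(g \<longlongrightarrow> p) at_top" "(g \<longlongrightarrow> m) at_bot"
  shows "m \<le> g x" "g x \<le> p"
proof -
  have "\<forall>\<^sub>F y in at_top. g x \<le> g y"
    using eventually_ge_at_top[of x] by eventually_elim (use assms(1) in \<open>auto dest: monoD\<close>)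
  then show "g x \<le> p" using assms(2) by (intro tendsto_lowerbound) auto
  have "\<forall>\<^sub>F y in at_bot. g y \<le> g x"
    using eventually_le_at_bot[of x] by eventually_elim (use assms(1) in \<open>auto dest: monoD\<close>)
  then show "m \<le> g x" using assms(3) by (intro tendsto_upperbound) auto
qed

text \<open>A monotone profile lies between its limits at the two ends. When these agree it is
  constant in \<open>x\<close>, contrary to the genuineness clause in
  \<open>solitary_wave\<close>.\<close>

lemma solitary_wave_not_monotone:
  assumes con: "connects \<phi> u_minus u_plus" and sol: "solitary_wave \<phi> u_minus u_plus"
  shows "\<not> spatially_monotone \<phi>"
proof
  assume mono: "spatially_monotone \<phi>"
  obtain t x y where ne: "\<phi> x t \<noteq> \<phi> y t" and eq: "u_plus t = u_minus t"
    using sol unfolding solitary_wave_def by blast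
  have lim: "((\<lambda>x. \<phi> x t) \<longlongrightarrow> u_plus t) at_top" "((\<lambda>x. \<phi> x t) \<longlongrightarrow> u_minus t) at_bot"
    using con unfolding connects_def by (auto intro: tendsto_uniform_limitI)
  have "\<phi> z t = u_plus t" for z
  proof (cases "mono (\<lambda>x. \<phi> x t)")
    case True
    from mono_between_limits[OF this lim, of z] show ?thesis using eq by simp
  next
    case False
    \<comment> \<open>The profile at this \<open>t\<close> is then antitone, and its negative is
      treated as in the first case, with negated limits.\<close>
    then have "mono (\<lambda>x. - \<phi> x t)"
      using mono unfolding spatially_monotone_def by (auto simp: mono_def antimono_def)
    from mono_between_limits[OF this tendsto_minus[OF lim(1)] tendsto_minus[OF lim(2)], of z]
    show ?thesis using eq by simp
  qed
  then show False using ne by metis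
qed

theorem theorem7p6:
  fixes f :: "real \<Rightarrow> real \<Rightarrow> real"
    and u_plus u_minus :: "real \<Rightarrow> real"
  assumes "C1_admissible f"
    and "uniformly_almost_periodic UNIV f"
    and "classical_solution f {0<..} (\<lambda>z t. u_plus t)"
    and "classical_solution f {0<..} (\<lambda>z t. u_minus t)"
    and "almost_periodic u_plus"
    and "almost_periodic u_minus"
    and "frequency_module1 u_plus \<subseteq> frequency_module f"
    and "frequency_module1 u_minus \<subseteq> frequency_module f"
    and "\<exists>\<epsilon>0>0. \<exists>\<mu>>0. \<forall>t u.
           \<bar>u - u_plus t\<bar> < \<epsilon>0 \<or> \<bar>u - u_minus t\<bar> < \<epsilon>0 \<longrightarrow> deriv (f t) u \<le> - \<mu>"
  shows "(\<forall>\<phi> c. ap_traveling_wave f \<phi> c \<and> connects \<phi> u_minus u_plus \<and> uniformly_stable f \<phi> c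
            \<longrightarrow> spatially_monotone \<phi>) \<and>
         (\<forall>\<phi> c. ap_traveling_wave f \<phi> c \<and> connects \<phi> u_minus u_plus \<and>
            solitary_wave \<phi> u_minus u_plus \<longrightarrow> \<not> uniformly_stable f \<phi> c)"
proof -
  obtain e0 \<mu> where e0: "e0 > 0" and \<mu>: "\<mu> > 0"
    and diss: "\<And>t u. \<bar>u - u_plus t\<bar> < e0 \<or> \<bar>u - u_minus t\<bar> < e0 \<Longrightarrow> deriv (f t) u \<le> - \<mu>"
    using assms(9) by blast
  have "spatially_monotone \<phi>"
    if "ap_traveling_wave f \<phi> c" "connects \<phi> u_minus u_plus" "uniformly_stable f \<phi> c" for \<phi> c
  proof -
    interpret stable_wave f \<phi> c u_minus u_plus e0 \<mu>
      by unfold_locales (fact assms(1) e0 \<mu> diss that)+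
    show ?thesis by (rule stable_wave_monotone)
  qed
  \<comment> \<open>The claim on solitary waves follows by contraposition from monotonicity of
    stable waves.\<close>
  then show ?thesis using solitary_wave_not_monotone by blast
qed

end
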